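(* Let $q=p^e$ be an odd prime power with $q\equiv 2\pmod 3$, and let $4\le k\le q+1$. Let $g_i(X)=X^3$ and $f_i(X)=X^{i-1}$ for each $3\le i\le k$. Then $S(k,q)=S(k,q;f_3,g_3,\ldots,f_k,g_k)$ is connected and $$\lambda_2(S(k,q))=\max\{q(k-3),\,(q-1)M_q\},$$ where $M_q=\max_{a,b\in\mathbb{F}_q^*}\varepsilon_{ax^3+bx}$, and moreover $M_q\le 2\sqrt q$.
   Context: For a prime power $q$, integer $k\ge3$, and polynomials $f_i,g_i\in\mathbb{F}_q[X]$ ($3\le i\le k$) of degree at most $q-1$ with $g_i(-X)=-g_i(X)$, the graph $S(k,q;f_3,g_3,\ldots,f_k,g_k)$ is the simple graph with vertex set $\mathbb{F}_q^k$ in which $a=(a_1,\ldots,a_k)$ and $b=(b_1,\ldots,b_k)$ are adjacent iff $a_1\ne b_1$ and $b_i-a_i=g_i(b_1-a_1)\,f_i\!\left(\frac{b_2-a_2}{b_1-a_1}\right)$ for all $3\le i\le k$. $\lambda_2$ is the second largest adjacency eigenvalue. With $q=p^e$, $Tr(\alpha)=\alpha+\alpha^p+\cdots+\alpha^{p^{e-1}}\in\mathbb{F}_p$, $\zeta_p=\exp(2\pi i/p)$, and $\zeta_p^\beta$ for $\beta\in\mathbb{F}_p$ means $\zeta_p^{\beta^*}$ with $\beta^*\in\{0,\ldots,p-1\}$ the representative of $\beta$. For $f\in\mathbb{F}_q[X]$, the exponential sum is $\varepsilon_f=\sum_{x\in\mathbb{F}_q}\zeta_p^{Tr(f(x))}$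 (a real number when $f$ is odd). *)

theory Defs
  imports "HOL-Analysis.Analysis" "Jordan_Normal_Form.Char_Poly"
begin

text \<open>Finite field: a type 'a of class field and finite; q = CARD('a), p = CHAR('a), q = p^e.\<close>

definition fftrace :: "nat \<Rightarrow> 'a::{field,finite} \<Rightarrow> 'a" where
  "fftrace e x = (\<Sum>j<e. x ^ (CHAR('a) ^ j))"

definition prime_field_rep :: "'a::{field,finite} \<Rightarrow> nat" where
  "prime_field_rep b = (THE n. n < CHAR('a) \<and> of_nat n = b)"

definition expsum :: "nat \<Rightarrow> ('a::{field,finite} \<Rightarrow> 'a) \<Rightarrow> complex" where
  "expsum e f = (\<Sum>x\<in>(UNIV::'a set).
      cis (2 * pi * real (prime_field_rep (fftrace e (f x))) / real CHAR('a)))"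

definition S_verts :: "nat \<Rightarrow> (nat \<Rightarrow> 'a::{field,finite}) set" where
  "S_verts k = {a. \<forall>i. i \<notin> {1..k} \<longrightarrow> a i = 0}"

definition S_adj :: "nat \<Rightarrow> (nat \<Rightarrow> 'a \<Rightarrow> 'a) \<Rightarrow> (nat \<Rightarrow> 'a \<Rightarrow> 'a)
    \<Rightarrow> (nat \<Rightarrow> 'a::{field,finite}) \<Rightarrow> (nat \<Rightarrow> 'a) \<Rightarrow> bool" where
  "S_adj k f g a b \<longleftrightarrow> a \<in> S_verts k \<and> b \<in> S_verts k \<and> a 1 \<noteq> b 1 \<and>
     (\<forall>i\<in>{3..k}. b i - a i = g i (b 1 - a 1) * f i ((b 2 - a 2) / (b 1 - a 1)))"

definition graph_connected :: "'v set \<Rightarrow> ('v \<Rightarrow> 'v \<Rightarrow> bool) \<Rightarrow> bool" where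
  "graph_connected V E \<longleftrightarrow>
     (\<forall>u\<in>V. \<forall>v\<in>V. (\<lambda>x y. x \<in> V \<and> y \<in> V \<and> E x y)\<^sup>*\<^sup>* u v)"

definition vert_enum :: "'v set \<Rightarrow> nat \<Rightarrow> 'v" where
  "vert_enum V = (SOME h. bij_betw h {..<card V} V)"

definition adj_matrix :: "'v set \<Rightarrow> ('v \<Rightarrow> 'v \<Rightarrow> bool) \<Rightarrow> real mat" where
  "adj_matrix V E = mat (card V) (card V)
     (\<lambda>(i,j). if E (vert_enum V i) (vert_enum V j) then 1 else 0)"

text \<open>Adjacency eigenvalues with multiplicity (roots of the characteristic polynomial;
  all real since the matrix is real symmetric), and the second largest one.\<close>
definition adj_eigenvalues :: "'v set \<Rightarrow> ('v \<Rightarrow> 'v \<Rightarrow> bool) \<Rightarrow> real multiset" where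
  "adj_eigenvalues V E = proots (char_poly (adj_matrix V E))"

definition lambda2 :: "'v set \<Rightarrow> ('v \<Rightarrow> 'v \<Rightarrow> bool) \<Rightarrow> real" where
  "lambda2 V E = (let M = adj_eigenvalues V E in Max_mset (M - {#Max_mset M#}))"

end

theory Submission
  imports Defs "HOL-Algebra.Algebraic_Closure_Type" "HOL-Number_Theory.Cong"
begin

text \<open>
  The graph is a Cayley graph of \<open>\<bbbF>\<^sub>q\<^sup>k\<close>, so its eigenvectors are the additive characters. The
  character indexed by \<open>w\<close> has eigenvalue \<open>\<Sum>\<^sub>y \<epsilon>(F(y), L(y)) - q\<close>, where \<open>\<epsilon>(a, b)\<close> is the exponential
  sum of \<open>a X\<^sup>3 + b X\<close>, \<open>L(y) = w\<^sub>1 + w\<^sub>2 y\<close> and \<open>F(y)\<close> is the sum of the \<open>w\<^sub>i y ^ (i - 1)\<close> for \<open>i \<ge> 3\<close>.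
  As \<open>q \<equiv> 2 (mod 3)\<close>, cubing is bijective, so \<open>\<epsilon>(a, b)\<close> is \<open>q\<close> if \<open>a = b = 0\<close> and \<open>0\<close> if exactly one
  of \<open>a\<close>, \<open>b\<close> vanishes. For \<open>L = 0\<close> the eigenvalue is governed by the number of zeros of \<open>F\<close>, which is at
  most \<open>k - 2\<close>; otherwise \<open>L\<close> has at most one zero and the eigenvalue is at most \<open>(q - 1) M\<^sub>q\<close>, attained
  for \<open>F(y) = a y\<^sup>3\<close> and \<open>L(y) = b y\<close> because \<open>\<epsilon>(a y\<^sup>3, b y) = \<epsilon>(a, b)\<close>. Connectedness follows since the
  trivial character alone attains the valency.

  For the bound on \<open>M\<^sub>q\<close>, let \<open>\<epsilon>\<^sub>n\<close> be the sum over the field with \<open>q ^ n\<close> elements. Then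
  \<open>\<epsilon>\<^sub>2\<^sub>n = 2 q ^ n - \<epsilon>\<^sub>n\<^sup>2\<close>, so if \<open>\<bar>\<epsilon>\<^sub>1\<bar> > 2 sqrt q\<close>, the ratio \<open>\<bar>\<epsilon>\<^sub>n\<bar> / sqrt (q ^ n)\<close> is unbounded along the powers
  of two, whereas a Stepanov-type argument bounds it by \<open>8 p\<close> for all even \<open>n\<close>.
\<close>

hide_const (open) Divisibility.prime Divisibility.irreducible Polynomials.degree Polynomials.lead_coeff
  UnivPoly.up_ring.coeff UnivPoly.up_ring.monom Coset.order Module.module.smult

section \<open>Additive characters of finite fields\<close>

lemma finite_field_power_card:
  fixes x :: "'a::{field,finite}"
  shows "x ^ CARD('a) = x"
proof (cases "x = 0")
  case False
  have "x * (\<Prod>y\<in>UNIV-{0}. x * y) = x * x ^ (CARD('a) - 1) * \<Prod>(UNIV-{0})"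
    by (simp add: prod.distrib mult_ac)
  also have "x * x ^ (CARD('a) - 1) = x ^ Suc (CARD('a) - 1)"
    by (subst power_Suc) auto
  also have "Suc (CARD('a) - 1) = CARD('a)"
    using finite_UNIV_card_ge_0[where ?'a = 'a] by simp
  also have "(\<Prod>y\<in>UNIV-{0}. x * y) = (\<Prod>y\<in>UNIV-{0}. y)"
    by (rule prod.reindex_bij_witness[of _ "\<lambda>y. y / x" "\<lambda>y. x * y"]) (use False in auto)
  finally show ?thesis
    by simp
qed (use finite_UNIV_card_ge_0[where ?'a = 'a] in auto)

lemma prime_CHAR_finite_field: "prime CHAR('a::{field,finite})"
  by (rule prime_CHAR_semidom) (rule finite_imp_CHAR_pos, simp)

text \<open>For \<open>m > 0\<close> this is the subfield with \<open>p ^ m\<close> elements of an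
  algebraically closed field of characteristic \<open>p\<close>, and the whole of a finite field
  with \<open>p ^ m\<close> elements. Both settings are used.\<close>

definition frob_fixed :: "nat \<Rightarrow> 'a::field set" where
  "frob_fixed m = {x. x ^ (CHAR('a) ^ m) = x}"

text \<open>The absolute trace of the field with \<open>p ^ m\<close> elements, as a polynomial
  function that also makes sense in larger fields.\<close>

definition trace_sum :: "nat \<Rightarrow> 'a::field \<Rightarrow> 'a" where
  "trace_sum m x = (\<Sum>j<m. x ^ (CHAR('a) ^ j))"

text \<open>Meaningful only on the prime field, where the description operator finds a representative.\<close>

definition prime_char :: "'a::field \<Rightarrow> complex" where
  "prime_char z = cis (2 * pi * real (THE n. n < CHAR('a) \<and> of_nat n = z) / real CHAR('a))"

definition add_char :: "nat \<Rightarrow> 'a::field \<Rightarrow> complex" where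
  "add_char m x = prime_char (trace_sum m x)"

definition cubic_sum :: "nat \<Rightarrow> 'a::field \<Rightarrow> 'a \<Rightarrow> complex" where
  "cubic_sum m a b = (\<Sum>x\<in>frob_fixed m. add_char m (a * x ^ 3 + b * x))"

section \<open>Fixed fields of powers of the Frobenius map\<close>

lemma frob_add:
  assumes "prime CHAR('a::field)"
  shows "(x + y :: 'a) ^ (CHAR('a) ^ m) = x ^ (CHAR('a) ^ m) + y ^ (CHAR('a) ^ m)"
  by (rule freshmans_dream'[OF assms refl])

lemma frob_minus:
  assumes "prime CHAR('a::field)"
  shows "(- x :: 'a) ^ (CHAR('a) ^ m) = - (x ^ (CHAR('a) ^ m))"
proof -
  have "(x + - x) ^ (CHAR('a) ^ m) = x ^ (CHAR('a) ^ m) + (- x) ^ (CHAR('a) ^ m)"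
    by (rule frob_add[OF assms])
  moreover have "(x + - x) ^ (CHAR('a) ^ m) = 0"
    using prime_gt_0_nat[OF assms] by (simp add: power_0_left)
  ultimately show ?thesis by (metis add_eq_0_iff)
qed

lemma frob_diff:
  assumes "prime CHAR('a::field)"
  shows "(x - y :: 'a) ^ (CHAR('a) ^ m) = x ^ (CHAR('a) ^ m) - y ^ (CHAR('a) ^ m)"
  using frob_add[OF assms, of x "-y" m] frob_minus[OF assms, of y m] by simp

lemma frob_of_nat:
  assumes "prime CHAR('a::field)"
  shows "(of_nat n :: 'a) ^ (CHAR('a) ^ m) = of_nat n"
  using prime_gt_0_nat[OF assms] by (induction n) (auto simp: frob_add[OF assms] power_0_left)

lemma frob_fixed_closed:
  fixes x y :: "'a::field"
  assumes "prime CHAR('a)"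
  shows "(0::'a) \<in> frob_fixed m" "(1::'a) \<in> frob_fixed m" "(of_nat n::'a) \<in> frob_fixed m"
    "(numeral k::'a) \<in> frob_fixed m"
    "x \<in> frob_fixed m \<Longrightarrow> y \<in> frob_fixed m \<Longrightarrow> x + y \<in> frob_fixed m"
    "x \<in> frob_fixed m \<Longrightarrow> y \<in> frob_fixed m \<Longrightarrow> x - y \<in> frob_fixed m"
    "x \<in> frob_fixed m \<Longrightarrow> y \<in> frob_fixed m \<Longrightarrow> x * y \<in> frob_fixed m"
    "x \<in> frob_fixed m \<Longrightarrow> y \<in> frob_fixed m \<Longrightarrow> x / y \<in> frob_fixed m"
    "x \<in> frob_fixed m \<Longrightarrow> - x \<in> frob_fixed m"
    "x \<in> frob_fixed m \<Longrightarrow> x ^ n \<in> frob_fixed m"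
proof -
  have *: "(of_nat n :: 'a) \<in> frob_fixed m" for n
    by (simp add: frob_fixed_def frob_of_nat[OF assms])
  show "(of_nat n :: 'a) \<in> frob_fixed m" by (rule *)
  show "(numeral k :: 'a) \<in> frob_fixed m" using *[of "numeral k"] by simp
  show "(0 :: 'a) \<in> frob_fixed m" "(1 :: 'a) \<in> frob_fixed m" using *[of 0] *[of 1] by auto
  show "x \<in> frob_fixed m \<Longrightarrow> x ^ n \<in> frob_fixed m"
    by (auto simp: frob_fixed_def) (metis power_mult mult.commute)
qed (auto simp: frob_fixed_def frob_add[OF assms] frob_diff[OF assms] frob_minus[OF assms]
      power_mult_distrib power_divide)

lemma frob_fixed_mult_exponent:
  assumes "(x::'a::field) \<in> frob_fixed m"
  shows "x \<in> frob_fixed (m * n)"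
proof (induction n)
  case (Suc n)
  have "x ^ (CHAR('a) ^ (m * Suc n)) = (x ^ (CHAR('a) ^ m)) ^ (CHAR('a) ^ (m * n))"
    by (simp add: power_add power_mult)
  thus ?case using Suc assms by (simp add: frob_fixed_def)
qed (simp add: frob_fixed_def)

lemma degree_monom_diff_X:
  "n > 1 \<Longrightarrow> degree (monom 1 n - [:0, 1:] :: 'a::field poly) = n"
  by (rule antisym, rule degree_diff_le)
    (auto simp: degree_monom_eq coeff_pCons split: nat.splits intro!: le_degree)

lemma prime_power_gt_1:
  assumes "prime (p::nat)" "m > 0"
  shows "p ^ m > 1"
  using one_less_power[OF prime_gt_1_nat[OF assms(1)] assms(2)] .

lemma frob_fixed_finite:
  assumes "prime CHAR('a::field)" "m > 0"
  shows "finite (frob_fixed m :: 'a set)" "card (frob_fixed m :: 'a set) \<le> CHAR('a) ^ m"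
proof -
  let ?n = "CHAR('a) ^ m"
  define P :: "'a poly" where "P = monom 1 ?n - [:0, 1:]"
  have n: "?n > 1" by (rule prime_power_gt_1[OF assms])
  have deg: "degree P = ?n" unfolding P_def by (rule degree_monom_diff_X[OF n])
  have P0: "P \<noteq> 0" using deg n by (metis degree_0 not_one_less_zero)
  have eq: "(frob_fixed m :: 'a set) = {x. poly P x = 0}"
    by (auto simp: frob_fixed_def P_def poly_monom)
  show "finite (frob_fixed m :: 'a set)" using poly_roots_finite[OF P0] eq by simp
  show "card (frob_fixed m :: 'a set) \<le> ?n" using card_poly_roots_bound[OF P0] eq deg by simp
qed

lemma rsquarefreeI_pderiv:
  fixes P :: "'a::field poly"
  assumes "\<And>a. poly (pderiv P) a \<noteq> 0"
  shows "rsquarefree P"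
  unfolding rsquarefree_def
proof (intro conjI allI)
  show P0: "P \<noteq> 0" using assms by auto
  fix a
  have "\<not> 2 \<le> order a P"
  proof
    assume "2 \<le> order a P"
    hence "[:-a, 1:] ^ 2 dvd P" by (simp add: order_divides P0)
    then obtain Q where "P = [:-a, 1:] ^ 2 * Q" by (rule dvdE)
    hence "P = [:-a, 1:] * ([:-a, 1:] * Q)" by (simp only: power2_eq_square mult.assoc)
    hence "pderiv P = [:-a, 1:] * (pderiv ([:-a, 1:] * Q)) + [:-a, 1:] * Q * pderiv [:-a, 1:]"
      by (simp only: pderiv_mult)
    hence "poly (pderiv P) a = 0" by (simp only: poly_add poly_mult) simp
    thus False using assms by blast
  qed
  thus "order a P = 0 \<or> order a P = 1" by linarith
qed

lemma card_roots_rsquarefree: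
  fixes P :: "'a::alg_closed_field poly"
  assumes "rsquarefree P"
  shows "card {x. poly P x = 0} = degree P"
proof -
  have P0: "P \<noteq> 0" using assms by (simp add: rsquarefree_def)
  obtain A where A: "size A = degree P" "P = smult (lead_coeff P) (\<Prod>x\<in>#A. [:-x, 1:])"
    using alg_closed_imp_factorization[OF P0] by blast
  have pr: "proots P = A"
  proof -
    have "proots P = proots (\<Prod>x\<in>#A. [:-x, 1:])"
      by (subst A(2)) (simp add: P0)
    also have "\<dots> = (\<Sum>p\<in>#image_mset (\<lambda>x. [:-x, 1:]) A. proots p)"
      using proots_prod_mset[of "image_mset (\<lambda>x. [:-x, 1:]) A"] by force
    also have "\<dots> = A" by (simp add: image_mset.compositionality o_def)
    finally show ?thesis .
  qed
  have "proots P = mset_set {x. poly P x = 0}"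
  proof (rule multiset_eqI)
    fix x
    show "count (proots P) x = count (mset_set {x. poly P x = 0}) x"
      using assms P0 poly_roots_finite[OF P0]
      by (metis (mono_tags, lifting) One_nat_def count_mset_set(1,3) count_proots mem_Collect_eq
          order_root rsquarefree_def)
  qed
  thus ?thesis using A(1) pr by (metis size_mset_set)
qed

text \<open>\<open>X ^ (p ^ m) - X\<close> has derivative \<open>-1\<close> in characteristic
  \<open>p\<close>, so its roots are distinct and as many as its degree.\<close>

lemma card_frob_fixed_alg_closed:
  assumes "prime CHAR('a::alg_closed_field)" "m > 0"
  shows "card (frob_fixed m :: 'a set) = CHAR('a) ^ m"
proof -
  define n where "n = CHAR('a) ^ m"
  define P :: "'a poly" where "P = monom 1 n - [:0, 1:]"
  have n: "n > 1" unfolding n_def by (rule prime_power_gt_1[OF assms])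
  have deg: "degree P = n" unfolding P_def by (rule degree_monom_diff_X[OF n])
  have "of_nat n = (0::'a)" using assms by (simp add: n_def)
  hence "pderiv P = - 1"
    by (simp add: P_def pderiv_diff pderiv_monom pderiv_pCons one_pCons)
  hence "rsquarefree P" by (intro rsquarefreeI_pderiv) simp
  from card_roots_rsquarefree[OF this] deg show ?thesis
    by (simp add: frob_fixed_def P_def poly_monom n_def)
qed

section \<open>The prime field and its canonical character\<close>

lemma frob_fixed_1:
  assumes "prime CHAR('a::field)"
  shows "(frob_fixed 1 :: 'a set) = of_nat ` {..<CHAR('a)}"
    and "inj_on (of_nat :: nat \<Rightarrow> 'a) {..<CHAR('a)}"
proof -
  show inj: "inj_on (of_nat :: nat \<Rightarrow> 'a) {..<CHAR('a)}"
  proof (rule linorder_inj_onI')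
    fix i j assume ij: "i \<in> {..<CHAR('a)}" "j \<in> {..<CHAR('a)}" "i < j"
    have "\<not> CHAR('a) dvd (j - i)" using ij by (auto dest!: dvd_imp_le)
    hence "of_nat (j - i) \<noteq> (0::'a)" by (simp add: of_nat_eq_0_iff_char_dvd)
    thus "of_nat i \<noteq> (of_nat j :: 'a)" using ij by (simp add: of_nat_diff)
  qed
  have fin: "finite (frob_fixed 1 :: 'a set)"
    by (rule frob_fixed_finite(1)[OF assms]) simp
  have "of_nat ` {..<CHAR('a)} \<subseteq> (frob_fixed 1 :: 'a set)"
    using frob_fixed_closed(3)[OF assms] by auto
  moreover have "card (frob_fixed 1 :: 'a set) \<le> card (of_nat ` {..<CHAR('a)} :: 'a set)"
    using frob_fixed_finite(2)[OF assms, of 1] by (simp add: card_image[OF inj])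
  ultimately show "(frob_fixed 1 :: 'a set) = of_nat ` {..<CHAR('a)}"
    by (rule card_seteq[OF fin, symmetric])
qed

text \<open>By periodicity of \<open>cis\<close>, any natural number may replace the reduced
  representative that the description operator selects; additivity of the character then follows
  from \<open>cis_mult\<close>.\<close>

lemma prime_char_of_nat:
  assumes "prime CHAR('a::field)"
  shows "prime_char (of_nat n :: 'a) = cis (2 * pi * real n / real CHAR('a))"
proof -
  let ?p = "CHAR('a)"
  have p: "?p > 0" using prime_gt_0_nat[OF assms] .
  have "(of_nat n :: 'a) = of_nat (n div ?p * ?p + n mod ?p)" by simp
  hence eq: "(of_nat (n mod ?p) :: 'a) = of_nat n"
    by (simp only: of_nat_add of_nat_mult of_nat_CHAR mult_zero_right add_0)
  have "(THE k. k < ?p \<and> of_nat k = (of_nat n :: 'a)) = n mod ?p"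
  proof (rule the_equality)
    show "n mod ?p < ?p \<and> of_nat (n mod ?p) = (of_nat n :: 'a)" using eq p by auto
    fix k assume "k < ?p \<and> of_nat k = (of_nat n :: 'a)"
    thus "k = n mod ?p" using inj_onD[OF frob_fixed_1(2)[OF assms], of k "n mod ?p"] eq p by auto
  qed
  hence "prime_char (of_nat n :: 'a) = cis (2 * pi * real (n mod ?p) / real ?p)"
    by (simp add: prime_char_def)
  also have "\<dots> = cis (2 * pi * real (n mod ?p) / real ?p) * cis (2 * pi * real (n div ?p))"
    by (simp add: cis_multiple_2pi)
  also have "\<dots> = cis (2 * pi * real (n mod ?p) / real ?p + 2 * pi * real (n div ?p))"
    by (rule cis_mult)
  also have "2 * pi * real (n mod ?p) / real ?p + 2 * pi * real (n div ?p)
      = 2 * pi * (real (n mod ?p) + real ?p * real (n div ?p)) / real ?p"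
    using p by (simp add: field_simps)
  also have "real (n mod ?p) + real ?p * real (n div ?p) = real n"
    by (metis mod_mult_div_eq of_nat_add of_nat_mult)
  finally show ?thesis .
qed

lemma prime_char_add:
  assumes "prime CHAR('a::field)" "x \<in> frob_fixed 1" "y \<in> frob_fixed 1"
  shows "prime_char (x + y :: 'a) = prime_char x * prime_char y"
proof -
  obtain m n where "x = of_nat m" "y = of_nat n"
    using assms frob_fixed_1(1)[OF assms(1)] by auto
  thus ?thesis
    using prime_char_of_nat[OF assms(1), of "m + n"]
    by (simp add: prime_char_of_nat[OF assms(1)] cis_mult add_divide_distrib distrib_left)
qed

lemma prime_char_0 [simp]:
  assumes "prime CHAR('a::field)"
  shows "prime_char (0 :: 'a) = 1"
  using prime_char_of_nat[OF assms, of 0] by simp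

lemma prime_char_eq_1_iff:
  assumes "prime CHAR('a::field)" "x \<in> frob_fixed 1"
  shows "prime_char (x :: 'a) = 1 \<longleftrightarrow> x = 0"
proof
  obtain n where n: "x = of_nat n" "n < CHAR('a)"
    using assms frob_fixed_1(1)[OF assms(1)] by auto
  assume "prime_char x = 1"
  hence "cos (2 * pi * real n / real CHAR('a)) = 1"
    by (metis n(1) prime_char_of_nat[OF assms(1)] cis.sel(1) one_complex.sel(1))
  then obtain k :: int where "2 * pi * real n / real CHAR('a) = real_of_int k * 2 * pi"
    by (auto simp: cos_one_2pi_int)
  hence "real n = real_of_int (k * int CHAR('a))"
    using n prime_gt_0_nat[OF assms(1)] by (simp add: field_simps)
  hence "int n = k * int CHAR('a)" using of_int_eq_iff[where ?'a=real] by fastforce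
  hence "n = 0" using n(2) by (metis dvd_triv_right int_dvd_int_iff dvd_imp_le not_less
      not_gr_zero)
  thus "x = 0" using n by simp
qed (simp add: assms)

section \<open>The trace and the orthogonality of additive characters\<close>

lemma trace_sum_add:
  assumes "prime CHAR('a::field)"
  shows "trace_sum m (x + y :: 'a) = trace_sum m x + trace_sum m y"
  by (simp add: trace_sum_def frob_add[OF assms] sum.distrib)

lemma trace_sum_frob:
  assumes "prime CHAR('a::field)"
  shows "trace_sum m (x :: 'a) ^ (CHAR('a) ^ n) = (\<Sum>j=n..<n+m. x ^ (CHAR('a) ^ j))"
proof -
  have "trace_sum m x ^ (CHAR('a) ^ n) = (\<Sum>j<m. (x ^ (CHAR('a) ^ j)) ^ (CHAR('a) ^ n))"
    unfolding trace_sum_def by (rule freshmans_dream_sum'[OF assms refl])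
  also have "\<dots> = (\<Sum>j<m. x ^ (CHAR('a) ^ (n + j)))"
    by (simp add: power_add power_mult[symmetric] mult.commute)
  also have "\<dots> = (\<Sum>j=n..<n+m. x ^ (CHAR('a) ^ j))"
    by (rule sum.reindex_bij_witness[of _ "\<lambda>j. j - n" "\<lambda>j. n + j"]) auto
  finally show ?thesis .
qed

text \<open>Frobenius shifts the terms of the trace by one, and \<open>x ^ (p ^ m) = x\<close> makes
  this shift cyclic.\<close>

lemma trace_sum_in_prime_field:
  assumes "prime CHAR('a::field)" "(x::'a) \<in> frob_fixed m"
  shows "trace_sum m x \<in> frob_fixed 1"
proof (cases m)
  case 0
  thus ?thesis using frob_fixed_closed(1)[OF assms(1)] by (simp add: trace_sum_def)
next
  case (Suc n)
  have "trace_sum m x ^ (CHAR('a) ^ 1) = (\<Sum>j=1..<1+m. x ^ (CHAR('a) ^ j))"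
    by (rule trace_sum_frob[OF assms(1)])
  also have "{1..<1+m} = insert m {1..<m}" using Suc by auto
  also have "(\<Sum>j\<in>insert m {1..<m}. x ^ (CHAR('a) ^ j)) = x + (\<Sum>j\<in>{1..<m}. x ^ (CHAR('a) ^ j))"
    using assms by (simp add: frob_fixed_def)
  also have "\<dots> = trace_sum m x"
    using Suc by (simp add: trace_sum_def lessThan_atLeast0 sum.atLeast_Suc_lessThan)
  finally show ?thesis by (simp add: frob_fixed_def)
qed

lemma add_char_add:
  assumes "prime CHAR('a::field)" "(x::'a) \<in> frob_fixed m" "y \<in> frob_fixed m"
  shows "add_char m (x + y) = add_char m x * add_char m y"
  unfolding add_char_def trace_sum_add[OF assms(1)]
  by (intro prime_char_add trace_sum_in_prime_field assms)

lemma add_char_0 [simp]: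
  assumes "prime CHAR('a::field)"
  shows "add_char m (0 :: 'a) = 1"
proof -
  have "trace_sum m (0 :: 'a) = 0"
    using prime_gt_0_nat[OF assms] by (simp add: trace_sum_def power_0_left)
  thus ?thesis by (simp add: add_char_def assms)
qed

lemma norm_add_char [simp]: "norm (add_char m x) = 1"
  by (simp add: add_char_def prime_char_def)

lemma add_char_minus:
  assumes "prime CHAR('a::field)" "(x::'a) \<in> frob_fixed m"
  shows "add_char m (- x) = cnj (add_char m x)"
proof -
  have "add_char m (x + - x) = add_char m x * add_char m (- x)"
    by (intro add_char_add assms frob_fixed_closed)
  hence "add_char m x * add_char m (- x) = 1" using assms by simp
  moreover have "add_char m x * cnj (add_char m x) = 1"
    by (simp add: complex_norm_square[symmetric])
  moreover have "add_char m x \<noteq> 0" by (metis norm_add_char norm_zero zero_neq_one)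
  ultimately show ?thesis by (metis mult_left_cancel)
qed

text \<open>The trace is a polynomial function of degree less than \<open>p ^ m\<close>.\<close>

lemma trace_sum_nonzero:
  assumes "prime CHAR('a::field)" "m > 0" "card (frob_fixed m :: 'a set) = CHAR('a) ^ m"
  shows "\<exists>x\<in>frob_fixed m. trace_sum m (x::'a) \<noteq> 0"
proof (rule ccontr)
  assume "\<not> ?thesis"
  hence zero: "\<And>x. x \<in> frob_fixed m \<Longrightarrow> trace_sum m (x::'a) = 0" by blast
  let ?p = "CHAR('a)"
  have p: "?p > 1" using prime_gt_1_nat[OF assms(1)] .
  define P :: "'a poly" where "P = (\<Sum>j<m. monom 1 (?p ^ j))"
  have "coeff P 1 = (\<Sum>j<m. if j = 0 then 1 else 0)"
    unfolding P_def coeff_sum using p by (intro sum.cong) (auto simp: coeff_monom)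
  also have "\<dots> = 1" using assms(2) by (simp add: sum.delta)
  finally have P0: "P \<noteq> 0" by auto
  have "degree P \<le> ?p ^ (m - 1)"
    unfolding P_def using p
    by (intro degree_sum_le) (auto intro!: order.trans[OF degree_monom_le] power_increasing)
  also have "\<dots> < ?p ^ m" using p assms(2) by (intro power_strict_increasing) auto
  finally have "degree P < ?p ^ m" .
  moreover have "frob_fixed m \<subseteq> {x. poly P x = 0}"
    using zero by (auto simp: P_def poly_sum poly_monom trace_sum_def)
  hence "card (frob_fixed m :: 'a set) \<le> card {x. poly P x = 0}"
    by (intro card_mono poly_roots_finite P0)
  ultimately show False using card_poly_roots_bound[OF P0] assms(3) by linarith
qed

text \<open>Translating the variable by \<open>y\<close> with \<open>c * y = z\<close> multiplies
  the sum by \<open>add_char m z\<close>; an element \<open>z\<close> of nonzero trace makes this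
  factor different from 1.\<close>

lemma sum_add_char:
  assumes "prime CHAR('a::field)" "m > 0" "card (frob_fixed m :: 'a set) = CHAR('a) ^ m"
    "(c::'a) \<in> frob_fixed m"
  shows "(\<Sum>x\<in>frob_fixed m. add_char m (c * x)) = (if c = 0 then of_nat (CHAR('a) ^ m) else 0)"
proof (cases "c = 0")
  case False
  obtain z :: 'a where z: "z \<in> frob_fixed m" "trace_sum m z \<noteq> 0"
    using trace_sum_nonzero[OF assms(1-3)] by blast
  note cl = frob_fixed_closed[OF assms(1)]
  define y where "y = z / c"
  have y: "y \<in> frob_fixed m" "c * y = z" using z assms(4) False by (auto simp: y_def intro: cl)
  have ne: "add_char m z \<noteq> 1"
    unfolding add_char_def using z prime_char_eq_1_iff[OF assms(1)]
      trace_sum_in_prime_field[OF assms(1)] by blast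
  let ?S = "\<Sum>x\<in>frob_fixed m. add_char m (c * x)"
  have "?S = (\<Sum>x\<in>frob_fixed m. add_char m (c * (x + y)))"
    by (rule sum.reindex_bij_witness[of _ "\<lambda>x. x + y" "\<lambda>x. x - y"]) (auto intro: cl y)
  also have "\<dots> = (\<Sum>x\<in>frob_fixed m. add_char m z * add_char m (c * x))"
    using y z assms
    by (intro sum.cong) (auto simp: distrib_left add_char_add[OF assms(1)] cl)
  also have "\<dots> = add_char m z * ?S" by (simp add: sum_distrib_left)
  finally show ?thesis using ne False by simp
qed (simp add: assms)

text \<open>Transitivity of the trace for a quadratic extension, as an identity between polynomial
  functions.\<close>

lemma trace_sum_double:
  assumes "prime CHAR('a::field)"
  shows "trace_sum (m * 2) (x::'a) = trace_sum m x + trace_sum m x ^ (CHAR('a) ^ m)"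
  unfolding trace_sum_frob[OF assms]
  by (simp add: trace_sum_def lessThan_atLeast0 sum.atLeastLessThan_concat mult_2_right)

section \<open>The Weil bound for cubic exponential sums\<close>

lemma CHAR_dvd_numeral_field:
  assumes "prime CHAR('a::field)" "prime n" "CHAR('a) \<noteq> n"
  shows "(of_nat n :: 'a) \<noteq> 0"
  using assms primes_dvd_imp_eq by (auto simp: of_nat_eq_0_iff_char_dvd)

text \<open>Every element of the subfield with \<open>p ^ m\<close> elements has both of its square roots either in
  this subfield or among the elements that the Frobenius map negates.\<close>

lemma sum_squares_frob_fixed:
  fixes F :: "'a::alg_closed_field \<Rightarrow> complex"
  assumes "prime CHAR('a)" "CHAR('a) \<noteq> 2" "m > 0"
  defines "K \<equiv> frob_fixed m" and "D \<equiv> {d::'a. d ^ (CHAR('a) ^ m) = - d}"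
  shows "(\<Sum>d\<in>K. F (d\<^sup>2)) + (\<Sum>d\<in>D. F (d\<^sup>2)) = 2 * (\<Sum>u\<in>K. F u)"
proof -
  let ?r = "CHAR('a) ^ m"
  note cl = frob_fixed_closed[OF assms(1)]
  have two: "(2::'a) \<noteq> 0"
    using CHAR_dvd_numeral_field[OF assms(1) two_is_prime_nat assms(2)] by simp
  have fK: "finite K" unfolding K_def by (rule frob_fixed_finite[OF assms(1,3)])
  have sqD: "d\<^sup>2 \<in> K" if "d \<in> D" for d
  proof -
    have "(d\<^sup>2) ^ ?r = (d ^ ?r)\<^sup>2" by (simp only: power_mult[symmetric] mult.commute)
    thus ?thesis using that by (simp add: K_def D_def frob_fixed_def)
  qed
  have sqK: "d\<^sup>2 \<in> K" if "d \<in> K" for d using that unfolding K_def by (rule cl)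
  have D2: "D \<subseteq> frob_fixed (m * 2)"
  proof
    fix d assume d: "d \<in> D"
    have "d ^ (CHAR('a) ^ (m * 2)) = (d ^ ?r) ^ ?r" by (simp add: power_mult power2_eq_square)
    also have "\<dots> = d" using d by (simp add: D_def frob_minus[OF assms(1)])
    finally show "d \<in> frob_fixed (m * 2)" by (simp add: frob_fixed_def)
  qed
  have fD: "finite D"
    by (rule finite_subset[OF D2]) (rule frob_fixed_finite[OF assms(1)], use assms(3) in simp)
  \<comment> \<open>Zero lies in both sets and is counted once in each; for
    \<open>u \<noteq> 0\<close> the two roots \<open>d\<close> and \<open>- d\<close> lie together
    in exactly one of them.\<close>
  have card2: "card {d\<in>K. d\<^sup>2 = u} + card {d\<in>D. d\<^sup>2 = u} = 2" if u: "u \<in> K" for u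
  proof -
    obtain d where d: "d ^ 2 = u" using nth_root_exists[of 2 u] by auto
    have roots: "x\<^sup>2 = u \<longleftrightarrow> x = d \<or> x = - d" for x
      unfolding d[symmetric] by (rule power2_eq_iff)
    have memK: "- d \<in> K \<longleftrightarrow> d \<in> K" unfolding K_def
      using cl(9)[of d m] cl(9)[of "- d" m] by auto
    have memD: "- d \<in> D \<longleftrightarrow> d \<in> D" unfolding D_def
      by (simp add: frob_minus[OF assms(1)]) (metis minus_minus)
    have "(d ^ ?r)\<^sup>2 = (d\<^sup>2) ^ ?r" by (simp only: power_mult[symmetric] mult.commute)
    also have "\<dots> = d\<^sup>2" using u d by (simp add: K_def frob_fixed_def)
    finally have "d ^ ?r = d \<or> d ^ ?r = - d" by (simp only: power2_eq_iff)
    hence or: "d \<in> K \<or> d \<in> D" unfolding K_def D_def frob_fixed_def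
      by (simp only: mem_Collect_eq)
    show ?thesis
    proof (cases "d = 0")
      case True
      hence "u = 0" using d by simp
      moreover have "0 \<in> K" "0 \<in> D"
        unfolding K_def D_def using cl(1) prime_gt_0_nat[OF assms(1)] by (simp_all add: power_0_left)
      ultimately have "{d\<in>K. d\<^sup>2 = u} = {0}" "{d\<in>D. d\<^sup>2 = u} = {0}" by auto
      thus ?thesis by simp
    next
      case False
      have ne: "d \<noteq> - d"
      proof
        assume "d = - d"
        hence "2 * d = 0" by (metis mult_2 add.right_inverse)
        thus False using two False by simp
      qed
      have excl: "\<not> (d \<in> K \<and> d \<in> D)" using ne unfolding K_def D_def frob_fixed_def by auto
      show ?thesis
      proof (cases "d \<in> K")
        case True
        hence *: "{d\<in>K. d\<^sup>2 = u} = {d, -d}" "{d\<in>D. d\<^sup>2 = u} = {}"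
          using roots memK memD excl by auto
        show ?thesis unfolding * using ne by simp
      next
        case F: False
        hence *: "{d\<in>K. d\<^sup>2 = u} = {}" "{d\<in>D. d\<^sup>2 = u} = {d, -d}"
          using roots memK memD or by auto
        show ?thesis unfolding * using ne by simp
      qed
    qed
  qed
  have grp: "(\<Sum>d\<in>Z. F (d\<^sup>2)) = (\<Sum>u\<in>K. of_nat (card {d\<in>Z. d\<^sup>2 = u}) * F u)"
    if "finite Z" "\<And>d. d \<in> Z \<Longrightarrow> d\<^sup>2 \<in> K" for Z
  proof -
    have "(\<Sum>d\<in>Z. F (d\<^sup>2)) = (\<Sum>u\<in>K. \<Sum>d\<in>{d\<in>Z. d\<^sup>2 = u}. F (d\<^sup>2))"
      by (rule sum.group[symmetric]) (use that fK in auto)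
    also have "\<dots> = (\<Sum>u\<in>K. \<Sum>d\<in>{d\<in>Z. d\<^sup>2 = u}. F u)" by (intro sum.cong) auto
    finally show ?thesis by simp
  qed
  have "(\<Sum>d\<in>K. F (d\<^sup>2)) + (\<Sum>d\<in>D. F (d\<^sup>2))
      = (\<Sum>u\<in>K. of_nat (card {d\<in>K. d\<^sup>2 = u} + card {d\<in>D. d\<^sup>2 = u}) * F u)"
    by (simp add: grp[OF fK sqK] grp[OF fD sqD] sum.distrib distrib_right)
  also have "\<dots> = 2 * (\<Sum>u\<in>K. F u)"
    by (simp only: card2 sum_distrib_left cong: sum.cong) simp
  finally show ?thesis .
qed

text \<open>Let \<open>s\<close> and \<open>d\<close> be the sum and the difference of
  \<open>x\<close> and \<open>y\<close>, respectively of \<open>z\<close> and its conjugate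
  \<open>z ^ r\<close>. The square of the small sum and the large sum become the same double sum,
  with \<open>d\<close> in \<open>K\<close> for one and among the elements negated by Frobenius for
  the other. Together the squares of \<open>d\<close> run twice through \<open>K\<close>, and
  orthogonality leaves only \<open>s = 0\<close>.\<close>

lemma cubic_sum_double:
  fixes a b :: "'a::alg_closed_field"
  assumes "prime CHAR('a)" "CHAR('a) \<noteq> 2" "CHAR('a) \<noteq> 3" "m > 0"
    and ab: "a \<in> frob_fixed m" "b \<in> frob_fixed m" "a \<noteq> 0"
  shows "cubic_sum (m * 2) a b = 2 * of_nat (CHAR('a) ^ m) - (cubic_sum m a b)\<^sup>2"
proof -
  define r where "r = CHAR('a) ^ m"
  define K :: "'a set" where "K = frob_fixed m"
  define D :: "'a set" where "D = {d. d ^ r = - d}"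
  define f where "f x = a * x ^ 3 + b * x" for x
  \<comment> \<open>The value of \<open>f x + f y\<close> in terms of \<open>s = x + y\<close> and
    \<open>u = (x - y)\<^sup>2\<close>. It is affine in \<open>u\<close> with slope
    \<open>3 * a * s / 4\<close>.\<close>
  define h where "h s u = a * (s ^ 3 + 3 * s * u) / 4 + b * s" for s u
  note pr = assms(1)
  note cl = frob_fixed_closed[where m = m, OF pr, folded K_def]
  have two: "(2::'a) \<noteq> 0"
    using CHAR_dvd_numeral_field[OF pr two_is_prime_nat assms(2)] by simp
  have three: "(3::'a) \<noteq> 0"
    using CHAR_dvd_numeral_field[OF pr _ assms(3)] by simp
  have "(4::'a) = 2 * 2" by simp
  hence four: "(4::'a) \<noteq> 0" using two by (metis mult_eq_0_iff)
  have fr: "(x + y) ^ r = x ^ r + y ^ r" "(x - y) ^ r = x ^ r - y ^ r" "(- x) ^ r = - (x ^ r)" for x y :: 'a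
    unfolding r_def by (rule frob_add[OF pr] frob_diff[OF pr] frob_minus[OF pr])+
  have Kr: "x \<in> K \<longleftrightarrow> x ^ r = x" for x by (simp add: K_def frob_fixed_def r_def)
  have K2r: "x \<in> frob_fixed (m * 2) \<longleftrightarrow> (x ^ r) ^ r = x" for x :: 'a
    by (simp add: frob_fixed_def r_def power_mult power2_eq_square)
  have ab': "a \<in> K" "b \<in> K" using ab by (simp_all add: K_def)
  have fh: "h (x + y) ((x - y)\<^sup>2) = f x + f y" for x y
  proof -
    have "a * ((x + y) ^ 3 + 3 * (x + y) * (x - y)\<^sup>2) = 4 * (a * x ^ 3 + a * y ^ 3)"
      by (simp add: power2_eq_square power3_eq_cube algebra_simps)
    thus ?thesis unfolding h_def f_def using four by (simp add: algebra_simps)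
  qed
  have half: "(x + y + (x - y)) / 2 = x" "(x + y - (x - y)) / 2 = y" for x y :: 'a
    using two by (simp_all add: field_simps)
  have fK: "f x \<in> K" if "x \<in> K" for x unfolding f_def by (intro cl that ab')
  have sq: "(cubic_sum m a b)\<^sup>2 = (\<Sum>s\<in>K. \<Sum>d\<in>K. add_char m (h s (d\<^sup>2)))"
  proof -
    have "(cubic_sum m a b)\<^sup>2 = (\<Sum>x\<in>K. \<Sum>y\<in>K. add_char m (f x + f y))"
      unfolding cubic_sum_def power2_eq_square sum_product f_def[symmetric] K_def[symmetric]
      by (intro sum.cong refl add_char_add[OF pr, symmetric]) (use fK K_def in auto)
    also have "\<dots> = (\<Sum>z\<in>K\<times>K. add_char m (f (fst z) + f (snd z)))"
      by (simp add: sum.cartesian_product case_prod_beta)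
    also have "\<dots> = (\<Sum>z\<in>K\<times>K. add_char m (h (fst z) ((snd z)\<^sup>2)))"
    proof (rule sum.reindex_bij_witness[of _ "\<lambda>z. ((fst z + snd z) / 2, (fst z - snd z) / 2)"
          "\<lambda>z. (fst z + snd z, fst z - snd z)"])
      fix z assume z: "z \<in> K \<times> K"
      show "((fst (fst z + snd z, fst z - snd z) + snd (fst z + snd z, fst z - snd z)) / 2,
          (fst (fst z + snd z, fst z - snd z) - snd (fst z + snd z, fst z - snd z)) / 2) = z"
        using two by (cases z) (simp add: field_simps)
      show "add_char m (h (fst (fst z + snd z, fst z - snd z)) ((snd (fst z + snd z, fst z - snd z))\<^sup>2))
          = add_char m (f (fst z) + f (snd z))"
        by (simp add: fh)
    qed (use two in \<open>auto intro!: cl simp: half add_divide_distrib[symmetric] diff_divide_distrib[symmetric]\<close>)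
    finally show ?thesis by (simp add: sum.cartesian_product case_prod_beta)
  qed
  have db: "cubic_sum (m * 2) a b = (\<Sum>s\<in>K. \<Sum>d\<in>D. add_char m (h s (d\<^sup>2)))"
  proof -
    have tr: "add_char (m * 2) (f z) = add_char m (f z + f (z ^ r))" for z
    proof -
      have "trace_sum (m * 2) (f z) = trace_sum m (f z) + trace_sum m (f z) ^ r"
        unfolding r_def by (rule trace_sum_double[OF pr])
      also have "trace_sum m (f z) ^ r = trace_sum m (f z ^ r)"
        unfolding r_def trace_sum_frob[OF pr]
        by (simp add: trace_sum_def power_mult[symmetric] power_add[symmetric])
          (rule sum.reindex_bij_witness[of _ "\<lambda>j. m + j" "\<lambda>j. j - m"], auto)
      also have "f z ^ r = f (z ^ r)"
        using ab' unfolding f_def fr power_mult_distrib Kr by (simp add: mult.commute flip: power_mult)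
      finally show ?thesis unfolding add_char_def trace_sum_add[OF pr] by simp
    qed
    have "cubic_sum (m * 2) a b = (\<Sum>z\<in>frob_fixed (m * 2). add_char m (f z + f (z ^ r)))"
      unfolding cubic_sum_def f_def[symmetric] tr ..
    also have "\<dots> = (\<Sum>z\<in>K\<times>D. add_char m (h (fst z) ((snd z)\<^sup>2)))"
    proof (rule sum.reindex_bij_witness[of _ "\<lambda>z. (fst z + snd z) / 2" "\<lambda>z. (z + z ^ r, z - z ^ r)"])
      fix z :: 'a assume z: "z \<in> frob_fixed (m * 2)"
      show "(fst (z + z ^ r, z - z ^ r) + snd (z + z ^ r, z - z ^ r)) / 2 = z"
        using two by (simp add: field_simps)
      show "(z + z ^ r, z - z ^ r) \<in> K \<times> D"
        using z by (simp add: K2r Kr D_def fr add.commute)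
      show "add_char m (h (fst (z + z ^ r, z - z ^ r)) ((snd (z + z ^ r, z - z ^ r))\<^sup>2))
          = add_char m (f z + f (z ^ r))"
        by (simp add: fh)
    next
      fix z assume z: "z \<in> K \<times> D"
      have t: "(2::'a) ^ r = 2" using cl(4) Kr by blast
      have zr: "((fst z + snd z) / 2) ^ r = (fst z - snd z) / 2"
        using z by (auto simp: power_divide fr Kr D_def t)
      show "(fst z + snd z) / 2 \<in> frob_fixed (m * 2)"
        unfolding K2r zr using z by (auto simp: power_divide fr Kr D_def t)
      show "((fst z + snd z) / 2 + ((fst z + snd z) / 2) ^ r,
          (fst z + snd z) / 2 - ((fst z + snd z) / 2) ^ r) = z"
        unfolding zr using two four by (cases z) (simp add: field_simps)
    qed
    finally show ?thesis by (simp add: sum.cartesian_product case_prod_beta)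
  qed
  \<comment> \<open>The slope in \<open>u\<close> vanishes only for \<open>s = 0\<close>, the
    characteristic being neither 2 nor 3; then \<open>h\<close> is 0 and every term equals
    1.\<close>
  have inner: "(\<Sum>u\<in>K. add_char m (h s u)) = (if s = 0 then of_nat r else 0)" if s: "s \<in> K" for s
  proof -
    let ?c = "a * s ^ 3 / 4 + b * s" and ?e = "3 * a * s / 4"
    have "h s u = ?c + ?e * u" for u unfolding h_def by (simp add: algebra_simps add_divide_distrib)
    hence "add_char m (h s u) = add_char m ?c * add_char m (?e * u)" if "u \<in> K" for u
      using add_char_add[OF pr, of ?c m "?e * u"] that s ab'
      by (simp add: K_def[symmetric] cl)
    hence "(\<Sum>u\<in>K. add_char m (h s u)) = add_char m ?c * (\<Sum>u\<in>K. add_char m (?e * u))"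
      by (simp add: sum_distrib_left)
    also have "(\<Sum>u\<in>K. add_char m (?e * u)) = (if ?e = 0 then of_nat r else 0)"
      unfolding K_def r_def
      by (rule sum_add_char[OF pr assms(4) card_frob_fixed_alg_closed[OF pr assms(4)]])
        (fold K_def, intro cl s ab')
    finally show ?thesis using four three ab(3) pr by simp
  qed
  have "(cubic_sum m a b)\<^sup>2 + cubic_sum (m * 2) a b
      = (\<Sum>s\<in>K. (\<Sum>d\<in>K. add_char m (h s (d\<^sup>2))) + (\<Sum>d\<in>D. add_char m (h s (d\<^sup>2))))"
    unfolding sq db by (simp add: sum.distrib)
  also have "\<dots> = (\<Sum>s\<in>K. 2 * (\<Sum>u\<in>K. add_char m (h s u)))"
    unfolding K_def D_def r_def by (intro sum.cong refl sum_squares_frob_fixed pr assms)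
  also have "\<dots> = (\<Sum>s\<in>K. if s = 0 then 2 * of_nat r else 0)"
    by (intro sum.cong) (auto simp: inner)
  also have "\<dots> = 2 * of_nat r"
    using frob_fixed_finite(1)[OF pr assms(4)] cl(1) by (simp add: K_def sum.delta)
  finally show ?thesis unfolding r_def by (simp add: algebra_simps)
qed

section \<open>Fibres of the trace of a cubic polynomial\<close>

lemma sum_poly_distinct_degrees_nonzero:
  fixes T :: "'i \<Rightarrow> 'a::comm_ring_1 poly"
  assumes "finite I" "I \<noteq> {}" "inj_on (\<lambda>i. degree (T i)) I" "\<And>i. i \<in> I \<Longrightarrow> T i \<noteq> 0"
  shows "sum T I \<noteq> 0"
proof -
  obtain i where i: "i \<in> I" "\<And>j. j \<in> I \<Longrightarrow> degree (T j) \<le> degree (T i)"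
    using ex_has_greatest_nat[of "\<lambda>i. i \<in> I" _ "\<lambda>i. degree (T i)" "Max ((\<lambda>i. degree (T i)) ` I) + 1"]
      assms(1,2) by (metis Max_ge all_not_in_conv finite_imageI imageI le_imp_less_Suc Suc_eq_plus1)
  have "coeff (sum T I) (degree (T i)) = (\<Sum>j\<in>I. coeff (T j) (degree (T i)))"
    by (rule coeff_sum)
  also have "\<dots> = (\<Sum>j\<in>I. if j = i then coeff (T i) (degree (T i)) else 0)"
  proof (intro sum.cong refl)
    fix j assume j: "j \<in> I"
    show "coeff (T j) (degree (T i)) = (if j = i then coeff (T i) (degree (T i)) else 0)"
    proof (cases "j = i")
      case False
      hence "degree (T j) \<noteq> degree (T i)" using assms(3) i(1) j by (auto dest: inj_onD)
      hence "degree (T j) < degree (T i)" using i(2)[OF j] by simp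
      thus ?thesis using False by (simp add: coeff_eq_0)
    qed simp
  qed
  also have "\<dots> = lead_coeff (T i)" using i(1) assms(1) by simp
  also have "\<dots> \<noteq> 0" using assms(4)[OF i(1)] by simp
  finally show ?thesis by auto
qed

lemma degree_sum_frobenius_powers:
  fixes f :: "'a::field poly"
  assumes "degree f > 0" "p > 1" "l > 0"
  shows "degree (\<Sum>j<l. f ^ (p ^ j)) = degree f * p ^ (l - 1)"
proof -
  obtain n where l: "l = Suc n" using assms(3) gr0_implies_Suc by blast
  have f0: "f \<noteq> 0" using assms(1) by auto
  have "degree (\<Sum>j<n. f ^ (p ^ j)) < degree (f ^ (p ^ n))"
  proof (rule degree_sum_less)
    fix j assume "j \<in> {..<n}"
    thus "degree (f ^ p ^ j) < degree (f ^ p ^ n)"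
      using assms f0 by (simp add: degree_power_eq power_strict_increasing)
  qed (use assms f0 in \<open>simp add: degree_power_eq\<close>)
  thus ?thesis using f0 by (simp add: l degree_add_eq_right degree_power_eq mult.commute)
qed

lemma card_polys_degree_less:
  "finite {P::'a::{field,finite} poly. degree P < n}"
  "card {P::'a::{field,finite} poly. degree P < n} \<le> CARD('a) ^ n"
proof -
  let ?V = "PiE {..<n} (\<lambda>_. UNIV :: 'a set)"
  have sub: "{P::'a poly. degree P < n} \<subseteq> (\<lambda>v. \<Sum>i<n. monom (v i) i) ` ?V"
  proof
    fix P :: "'a poly" assume "P \<in> {P. degree P < n}"
    hence deg: "degree P < n" by simp
    have "P = (\<Sum>i<n. monom (coeff P i) i)"
      by (rule poly_eqI) (use deg in \<open>auto simp: coeff_sum coeff_monom coeff_eq_0\<close>)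
    also have "\<dots> = (\<Sum>i<n. monom (restrict (coeff P) {..<n} i) i)" by (intro sum.cong) auto
    finally show "P \<in> (\<lambda>v. \<Sum>i<n. monom (v i) i) ` ?V" 
      by (rule image_eqI[where x = "restrict (coeff P) {..<n}"]) auto
  qed
  have fin: "finite ?V" by (intro finite_PiE) auto
  show "finite {P::'a poly. degree P < n}" by (rule finite_subset[OF sub]) (simp add: fin)
  have "card {P::'a poly. degree P < n} \<le> card ((\<lambda>v. \<Sum>i<n. monom (v i) i) ` ?V)"
    by (intro card_mono sub finite_imageI fin)
  also have "\<dots> \<le> card ?V" by (rule card_image_le[OF fin])
  also have "\<dots> = CARD('a) ^ n" by (simp add: card_PiE)
  finally show "card {P::'a poly. degree P < n} \<le> CARD('a) ^ n" .
qed

interpretation to_ac_hom: inj_idom_hom to_ac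
  by unfold_locales auto

interpretation to_ac_poly_hom: map_poly_inj_idom_hom to_ac ..

text \<open>A Stepanov-type argument without derivatives: with \<open>r = p ^ l\<close>, the elements \<open>x\<close> of trace \<open>t\<close>
  satisfy \<open>g(x) ^ r = t - g(x)\<close> and \<open>x ^ (r * r) = x\<close>, so that a combination of the polynomials
  \<open>X ^ (k + r i) g ^ j\<close> turns under the \<open>r\<close>-th power into the same combination of the
  \<open>X ^ (r k + i) (t - g) ^ j\<close>. By the pigeonhole principle the latter can be made to vanish
  identically, while the former cannot vanish, its terms having distinct degrees.\<close>

lemma card_trace_fibre_le:
  fixes a b t :: "'a::{field,finite}"
  assumes "CARD('a) = CHAR('a) ^ e" "CHAR('a) \<noteq> 2" "CHAR('a) \<noteq> 3" "a \<noteq> 0" "e dvd l" "l > 0"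
  shows "card {x \<in> frob_fixed (l * 2). trace_sum (l * 2) (to_ac a * x ^ 3 + to_ac b * x) = to_ac t}
    \<le> CHAR('a) ^ (l * 2 - 1) + 8 * CHAR('a) ^ l"
proof -
  define p where "p = CHAR('a)"
  have pr: "prime p" unfolding p_def by (rule prime_CHAR_finite_field)
  have p5: "p \<ge> 5"
  proof -
    have "p > 1" "p \<noteq> 2" "p \<noteq> 3" using prime_gt_1_nat[OF pr] assms(2,3) by (auto simp: p_def)
    moreover have "p \<noteq> 4" using pr by (auto simp: prime_nat_iff'
          dest: spec[of _ 2] bspec[of _ _ 2])
    ultimately show ?thesis by linarith
  qed
  define r' where "r' = p ^ (l - 1)"
  define r where "r = p ^ l"
  have r': "r' > 0" using p5 by (simp add: r'_def)
  have r: "r = p * r'" using assms(6) by (simp add: r_def r'_def power_eq_if)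
  have rr: "p ^ (l * 2 - 1) = r * r'" using assms(6)
    by (simp add: r_def r'_def mult_2_right flip: power_add)
  \<comment> \<open>As \<open>e\<close> divides \<open>l\<close>, \<open>r\<close> is a power of the
    order of the base field, so the \<open>r\<close>-th power fixes all coefficients.\<close>
  have powr: "c ^ r = c" for c :: 'a
  proof -
    obtain s where "l = e * s" using assms(5) by (elim dvdE)
    hence "r = CARD('a) ^ s" by (simp add: r_def p_def assms(1) power_mult)
    moreover have "c ^ (CARD('a) ^ s) = c"
      by (induction s) (simp_all add: power_mult finite_field_power_card)
    ultimately show ?thesis by simp
  qed
  define f where "f = [:0, b, 0, a:]"
  \<comment> \<open>On the field with \<open>r * r\<close> elements, the trace of \<open>f\<close>
    is \<open>g + g ^ r\<close>.\<close>
  define g where "g = (\<Sum>j<l. f ^ (p ^ j))"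
  have degf: "degree f = 3" using assms(4) by (simp add: f_def)
  have degg: "degree g = 3 * r'"
    unfolding g_def r'_def using degf p5 assms(6) by (subst degree_sum_frobenius_powers) auto
  \<comment> \<open>The number of exponents \<open>i\<close> is chosen so that the
    \<open>N * r\<close> free coefficients outnumber the \<open>M\<close> coefficients of
    \<open>G c\<close>: as \<open>p \<ge> 5\<close>, \<open>N * r = r * r' + 4 * r\<close> exceeds
    \<open>M = r * r' + 2 * r + r' + 4\<close>.\<close>
  define N where "N = r' + 4"
  define J where "J = {..<N} \<times> {..<p} \<times> {..<r'}"
  define hterm where "hterm = (\<lambda>(i, j, k). monom (1::'a) (k + r * i) * g ^ j)"
  define gterm where "gterm = (\<lambda>(i, j, k). monom (1::'a) (r * k + i) * ([:t:] - g) ^ j)"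
  define G where "G c = (\<Sum>z\<in>J. smult (c z) (gterm z))" for c
  define M where "M = r * r' + 2 * r + N"
  have finJ: "finite J" by (simp add: J_def)
  have cardJ: "card J = N * r" by (simp add: J_def r)
  have g0: "g \<noteq> 0" using degg r' by auto
  have degG: "degree (G c) < M" for c
  proof -
    have "degree (G c) \<le> r * r' + 2 * r + N - 1"
      unfolding G_def
    proof (intro degree_sum_le finJ order.trans[OF degree_smult_le])
      fix z assume "z \<in> J"
      then obtain i j k where z: "z = (i, j, k)" "i < N" "j < p" "k < r'" by (auto simp: J_def)
      have "degree ([:t:] - g) \<le> 3 * r'" using degg by (intro degree_diff_le) auto
      hence "degree (([:t:] - g) ^ j) \<le> 3 * r' * j"
        by (metis degree_power_le mult_le_mono1 order.trans)
      hence "degree (gterm z) \<le> (r * k + i) + 3 * r' * j"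
        unfolding gterm_def z prod.case
        by (intro order.trans[OF degree_mult_le] add_mono) (auto intro: degree_monom_le)
      moreover have "r * (k + 1) \<le> r * r'" "3 * r' * (j + 1) \<le> 3 * r' * p"
        using z by (intro mult_left_mono; simp)+
      moreover have "3 * r' * p = 3 * r" by (simp add: r)
      ultimately show "degree (gterm z) \<le> r * r' + 2 * r + N - 1"
        using z(2) by (simp add: algebra_simps)
    qed
    thus ?thesis by (simp add: M_def N_def)
  qed
  have "\<not> inj_on G (PiE J (\<lambda>_. UNIV))"
  proof
    assume inj: "inj_on G (PiE J (\<lambda>_. UNIV))"
    have "CARD('a) ^ (N * r) = card (PiE J (\<lambda>_. UNIV :: 'a set))"
      by (simp add: card_PiE finJ cardJ)
    also have "\<dots> = card (G ` PiE J (\<lambda>_. UNIV))" using card_image[OF inj] by simp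
    also have "\<dots> \<le> card {P::'a poly. degree P < M}"
      by (intro card_mono card_polys_degree_less) (use degG in auto)
    also have "\<dots> \<le> CARD('a) ^ M" by (rule card_polys_degree_less)
    finally have "N * r \<le> M"
      using card_mono[of UNIV "{0, 1::'a}"] by (simp add: power_le_imp_le_exp)
    hence "2 * r \<le> r' + 4" by (simp add: N_def M_def algebra_simps)
    moreover have "r \<ge> 5 * r'" unfolding r using p5 by simp
    ultimately show False using r' by linarith
  qed
  then obtain c1 c2 where c12: "c1 \<in> PiE J (\<lambda>_. UNIV)" "c2 \<in> PiE J (\<lambda>_. UNIV)" "c1 \<noteq> c2" "G c1 = G c2"
    by (auto simp: inj_on_def)
  \<comment> \<open>\<open>G\<close> is linear, so the difference of two colliding families is a
    nonzero family that \<open>G\<close> sends to 0.\<close>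
  define c where "c z = c1 z - c2 z" for z
  have Gc: "G c = 0"
  proof -
    have "G c = G c1 - G c2" by (simp add: G_def c_def smult_diff_left sum_subtractf)
    thus ?thesis using c12(4) by simp
  qed
  define J' where "J' = {z \<in> J. c z \<noteq> 0}"
  have J'ne: "J' \<noteq> {}"
  proof
    assume "J' = {}"
    hence "c z = 0" if "z \<in> J" for z using that unfolding J'_def by blast
    hence "c1 z = c2 z" if "z \<in> J" for z using that by (simp add: c_def)
    hence "c1 = c2" using c12(1,2) by (intro PiE_ext)
    thus False using c12(3) by simp
  qed
  define H where "H = (\<Sum>z\<in>J. smult (c z) (hterm z))"
  have hne: "hterm z \<noteq> 0" for z
    using g0 by (auto simp: hterm_def monom_eq_0_iff split: prod.splits)
  \<comment> \<open>The degree determines the index: \<open>k < r'\<close> is its residue modulo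
    \<open>r'\<close>, then \<open>3 * j\<close> is known modulo \<open>p\<close>, which fixes
    \<open>j < p\<close> because \<open>p \<noteq> 3\<close>, and \<open>i\<close> is what
    remains.\<close>
  have degh: "degree (hterm (i, j, k)) = k + r' * (p * i + 3 * j)" for i j k
    using g0 degg by (simp add: hterm_def degree_mult_eq monom_eq_0_iff degree_monom_eq
        degree_power_eq r algebra_simps)
  have H0: "H \<noteq> 0"
  proof -
    have "H = (\<Sum>z\<in>J'. smult (c z) (hterm z))"
      unfolding H_def J'_def by (rule sum.mono_neutral_right) (use finJ in auto)
    also have "\<dots> \<noteq> 0"
    proof (rule sum_poly_distinct_degrees_nonzero)
      show "inj_on (\<lambda>z. degree (smult (c z) (hterm z))) J'"
      proof (rule inj_onI)
        fix z w assume zw: "z \<in> J'" "w \<in> J'"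
          and eq: "degree (smult (c z) (hterm z)) = degree (smult (c w) (hterm w))"
        obtain i j k where z: "z = (i, j, k)" "i < N" "j < p" "k < r'" using zw by (auto simp: J_def J'_def)
        obtain i' j' k' where w: "w = (i', j', k')" "i' < N" "j' < p" "k' < r'"
          using zw by (auto simp: J_def J'_def)
        have eq': "k + r' * (p * i + 3 * j) = k' + r' * (p * i' + 3 * j')"
          using eq zw unfolding z(1) w(1) by (simp add: J'_def degh)
        have "k = k'" using arg_cong[OF eq', of "\<lambda>n. n mod r'"] z w by simp
        hence eq'': "p * i + 3 * j = p * i' + 3 * j'" using eq' r' by simp
        hence "[3 * j = 3 * j'] (mod p)"
          by (metis cong_def mod_mult_self4)
        moreover have "coprime 3 p" using pr assms(3) by (simp add: primes_coprime p_def[symmetric])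
        ultimately have "[j = j'] (mod p)" by (simp add: cong_mult_lcancel_nat)
        hence "j = j'" using z w by (simp add: cong_def)
        moreover from this have "i = i'" using eq'' p5 by simp
        ultimately show "z = w" using \<open>k = k'\<close> z w by simp
      qed
    qed (use finJ J'ne hne in \<open>auto simp: J'_def\<close>)
    finally show ?thesis .
  qed
  \<comment> \<open>The main part \<open>r * r' = p ^ (l * 2 - 1)\<close> is the average size of a
    fibre of the trace; the rest is a constant multiple of \<open>r\<close>.\<close>
  have degH: "degree H \<le> r * r' + 8 * r"
    unfolding H_def
  proof (intro degree_sum_le finJ order.trans[OF degree_smult_le])
    fix z assume "z \<in> J"
    then obtain i j k where z: "z = (i, j, k)" "i < N" "j < p" "k < r'" by (auto simp: J_def)
    have "degree (hterm z) = k + r * i + 3 * r' * j" unfolding z degh by (simp add: r algebra_simps)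
    moreover have "r * (i + 1) \<le> r * N" "3 * r' * (j + 1) \<le> 3 * r' * p"
      using z by (intro mult_left_mono; simp)+
    moreover have "3 * r' * p = 3 * r" "r' \<le> r" using p5 by (simp_all add: r)
    ultimately show "degree (hterm z) \<le> r * r' + 8 * r"
      using z(4) by (simp add: algebra_simps N_def)
  qed
  let ?S = "{x \<in> frob_fixed (l * 2). trace_sum (l * 2) (to_ac a * x ^ 3 + to_ac b * x) = to_ac t}"
  let ?H = "map_poly to_ac H"
  have sub: "?S \<subseteq> {x. poly ?H x = 0}"
  proof safe
    fix x :: "'a alg_closure"
    assume x: "x \<in> frob_fixed (l * 2)"
      and tr: "trace_sum (l * 2) (to_ac a * x ^ 3 + to_ac b * x) = to_ac t"
    have pr': "prime CHAR('a alg_closure)" using pr by (simp add: p_def)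
    define ev where "ev P = poly (map_poly to_ac P) x" for P
    have ev: "ev (P + Q) = ev P + ev Q" "ev (P - Q) = ev P - ev Q" "ev (P * Q) = ev P * ev Q"
      "ev (P ^ n) = ev P ^ n" "ev (smult u P) = to_ac u * ev P" "ev (monom u n) = to_ac u * x ^ n"
      "ev [:u:] = to_ac u" for P Q u n
      by (simp_all add: ev_def hom_distribs poly_monom map_poly_monom)
    have evs: "ev (sum P A) = (\<Sum>z\<in>A. ev (P z))" for P :: "'b \<Rightarrow> _" and A
      by (simp add: ev_def hom_distribs poly_sum)
    have evf: "ev f = to_ac a * x ^ 3 + to_ac b * x"
      by (simp add: ev_def f_def to_ac_hom.map_poly_pCons_hom power3_eq_cube algebra_simps)
    have xr: "(x ^ r) ^ r = x"
      using x by (simp add: frob_fixed_def r_def p_def power_mult power2_eq_square)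
    have gr: "ev g ^ r = to_ac t - ev g"
    proof -
      have "ev g = (\<Sum>j<l. ev f ^ (p ^ j))" by (simp add: g_def evs ev)
      also have "\<dots> = trace_sum l (ev f)" by (simp add: trace_sum_def p_def)
      finally have "ev g + ev g ^ r = trace_sum (l * 2) (ev f)"
        using trace_sum_double[OF pr', of l "ev f"] by (simp add: r_def p_def)
      also have "\<dots> = to_ac t" using tr by (simp add: evf)
      finally show ?thesis by (simp add: algebra_simps)
    qed
    have termr: "(to_ac (c z) * ev (hterm z)) ^ r = to_ac (c z) * ev (gterm z)" for z
    proof -
      obtain i j k where z: "z = (i, j, k)" by (cases z)
      have "(x ^ (k + r * i)) ^ r = (x ^ r) ^ k * ((x ^ r) ^ r) ^ i"
        by (simp add: power_add power_mult_distrib flip: power_mult) (simp add: mult_ac)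
      also have "\<dots> = x ^ (r * k + i)" by (simp add: xr power_add power_mult)
      finally have 1: "(x ^ (k + r * i)) ^ r = x ^ (r * k + i)" .
      have "(ev g ^ j) ^ r = (ev g ^ r) ^ j" by (simp add: mult.commute flip: power_mult)
      hence 2: "(ev g ^ j) ^ r = (to_ac t - ev g) ^ j" by (simp add: gr)
      have 3: "to_ac (c z) ^ r = to_ac (c z)" by (simp flip: to_ac_power add: powr)
      show ?thesis unfolding power_mult_distrib 3
        by (simp add: z hterm_def gterm_def ev power_mult_distrib 1 2)
    qed
    have "ev H ^ r = (\<Sum>z\<in>J. (to_ac (c z) * ev (hterm z)) ^ r)"
      unfolding H_def evs ev r_def p_def by (rule freshmans_dream_sum'[OF pr']) simp
    also have "\<dots> = ev (G c)" by (simp add: termr G_def evs ev)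
    also have "\<dots> = 0" by (simp add: Gc ev_def)
    finally show "poly ?H x = 0" by (simp add: ev_def)
  qed
  have H0': "?H \<noteq> 0" using H0 by simp
  have "card ?S \<le> card {x. poly ?H x = 0}"
    by (intro card_mono sub poly_roots_finite H0')
  also have "\<dots> \<le> degree ?H" by (rule card_poly_roots_bound[OF H0'])
  also have "degree ?H = degree H" by simp
  finally show ?thesis using degH unfolding p_def[symmetric] rr r_def[symmetric] by linarith
qed

text \<open>An upper bound \<open>B\<close> for the fibre sizes \<open>N t\<close> suffices. As the
  values \<open>prime_char t\<close> add up to 0, \<open>N t\<close> may be replaced by
  \<open>N t - B\<close>, and the nonnegative numbers \<open>B - N t\<close> have total
  \<open>p * B - p ^ (l * 2)\<close>, in which the main terms cancel.\<close>

lemma norm_cubic_sum_double_le: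
  fixes a b :: "'a::{field,finite}"
  assumes "CARD('a) = CHAR('a) ^ e" "CHAR('a) \<noteq> 2" "CHAR('a) \<noteq> 3" "a \<noteq> 0" "e dvd l" "l > 0"
  shows "norm (cubic_sum (l * 2) (to_ac a) (to_ac b)) \<le> 8 * real CHAR('a) * real CHAR('a) ^ l"
proof -
  define p where "p = CHAR('a)"
  have pr: "prime CHAR('a)" by (rule prime_CHAR_finite_field)
  hence pr': "prime CHAR('a alg_closure)" by simp
  have p0: "p > 0" using prime_gt_0_nat[OF pr] by (simp add: p_def)
  define K :: "'a alg_closure set" where "K = frob_fixed (l * 2)"
  define F :: "'a alg_closure set" where "F = frob_fixed 1"
  define T where "T x = trace_sum (l * 2) (to_ac a * x ^ 3 + to_ac b * x)" for x
  define N where "N t = real (card {x\<in>K. T x = t})" for t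
  define B where "B = real p ^ (l * 2 - 1) + 8 * real p ^ l"
  note cl = frob_fixed_closed[OF pr']
  have ac: "to_ac c \<in> frob_fixed (l * 2)" for c :: 'a
  proof -
    obtain s where s: "l = e * s" using assms(5) by (elim dvdE)
    have "to_ac c \<in> frob_fixed e"
      using finite_field_power_card[of c] by (simp add: frob_fixed_def assms(1) flip: to_ac_power)
    thus ?thesis using frob_fixed_mult_exponent[of "to_ac c" e "s * 2"] by (simp add: s mult.assoc)
  qed
  have finK: "finite K" and cardK: "card K = p ^ (l * 2)"
    unfolding K_def p_def using frob_fixed_finite(1)[OF pr', of "l * 2"]
      card_frob_fixed_alg_closed[OF pr', of "l * 2"] assms(6) by auto
  have finF: "finite F" and cardF: "card F = p"
    unfolding F_def p_def using frob_fixed_finite(1)[OF pr', of 1]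
      card_frob_fixed_alg_closed[OF pr', of 1] by auto
  have TF: "T x \<in> F" if "x \<in> K" for x
    unfolding T_def F_def by (intro trace_sum_in_prime_field pr' cl ac) (use that in \<open>simp_all add: K_def\<close>)
  have NB: "N t \<le> B" if t: "t \<in> F" for t
  proof -
    obtain n where "t = of_nat n" using t frob_fixed_1(1)[OF pr'] by (auto simp: F_def)
    hence n: "t = to_ac (of_nat n)" by simp
    have "card {x\<in>K. T x = t} \<le> p ^ (l * 2 - 1) + 8 * p ^ l"
      unfolding K_def T_def n p_def by (rule card_trace_fibre_le[OF assms])
    hence "N t \<le> real (p ^ (l * 2 - 1) + 8 * p ^ l)" unfolding N_def by (simp only: of_nat_le_iff)
    thus ?thesis by (simp add: B_def)
  qed
  have sumN: "(\<Sum>t\<in>F. N t) = real p ^ (l * 2)"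
  proof -
    have "(\<Sum>t\<in>F. card {x\<in>K. T x = t}) = card K"
      using sum.group[OF finK finF, of T "\<lambda>_. 1::nat"] TF by (simp add: image_subset_iff)
    hence "(\<Sum>t\<in>F. N t) = real (card K)" unfolding N_def by (simp flip: of_nat_sum)
    thus ?thesis by (simp add: cardK)
  qed
  have sum0: "(\<Sum>t\<in>F. prime_char t) = 0"
    using sum_add_char[OF pr', of 1 1] card_frob_fixed_alg_closed[OF pr', of 1] cl(2)
    by (simp add: add_char_def trace_sum_def F_def)
  have "cubic_sum (l * 2) (to_ac a) (to_ac b) = (\<Sum>x\<in>K. prime_char (T x))"
    by (simp add: cubic_sum_def add_char_def K_def T_def)
  also have "\<dots> = (\<Sum>t\<in>F. \<Sum>x\<in>{x\<in>K. T x = t}. prime_char (T x))"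
    by (rule sum.group[symmetric]) (use finK finF TF in auto)
  also have "\<dots> = (\<Sum>t\<in>F. of_real (N t) * prime_char t)"
    by (intro sum.cong) (simp_all add: N_def)
  also have "\<dots> = (\<Sum>t\<in>F. of_real (N t) * prime_char t) - of_real B * (\<Sum>t\<in>F. prime_char t)"
    by (simp add: sum0)
  also have "\<dots> = (\<Sum>t\<in>F. of_real (N t - B) * prime_char t)"
    by (simp add: sum_distrib_left sum_subtractf left_diff_distrib)
  finally have "norm (cubic_sum (l * 2) (to_ac a) (to_ac b))
      \<le> (\<Sum>t\<in>F. norm (of_real (N t - B) * prime_char t))"
    by (simp only: norm_sum)
  also have "\<dots> = (\<Sum>t\<in>F. B - N t)"
    by (intro sum.cong) (use NB in \<open>auto simp: norm_mult prime_char_def simp flip: of_real_diff\<close>)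
  also have "\<dots> = real p * B - real p ^ (l * 2)"
    by (simp add: sum_subtractf sumN cardF)
  also have "\<dots> = 8 * real p * real p ^ l"
    using assms(6) by (simp add: B_def algebra_simps power_eq_if[of _ "l * 2"])
  finally show ?thesis by (simp add: p_def)
qed

section \<open>Amplification through quadratic extensions to the sharp bound\<close>

lemma square_minus_two_growth:
  fixes v :: "nat \<Rightarrow> real"
  assumes "\<And>j. v (Suc j) \<ge> (v j)\<^sup>2 - 2" "v 0 \<ge> 2"
  shows "v j \<ge> 2 + 4 ^ j * (v 0 - 2)"
proof (induction j)
  case (Suc j)
  have pos: "0 \<le> 4 ^ j * (v 0 - 2)" using assms(2) by simp
  \<comment> \<open>As \<open>v j \<ge> 2\<close>, the factor \<open>v j + 2\<close> is at least 4,
    so the excess over 2 at least quadruples.\<close>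
  have "4 * (v j - 2) \<le> (v j + 2) * (v j - 2)"
    using Suc pos by (intro mult_right_mono) linarith+
  also have "\<dots> = (v j)\<^sup>2 - 4" by (simp add: power2_eq_square algebra_simps)
  finally have "v (Suc j) \<ge> 2 + 4 * (v j - 2)" using assms(1)[of j] by linarith
  thus ?case using Suc by (simp add: algebra_simps)
qed simp

lemma norm_cubic_sum_le:
  fixes a b :: "'a::{field,finite}"
  assumes "CARD('a) = CHAR('a) ^ e" "CHAR('a) \<noteq> 2" "CHAR('a) \<noteq> 3" "a \<noteq> 0"
  shows "norm (cubic_sum e (to_ac a) (to_ac b)) \<le> 2 * sqrt (real CARD('a))"
proof -
  define p where "p = CHAR('a)"
  have pr: "prime CHAR('a)" by (rule prime_CHAR_finite_field)
  hence pr': "prime CHAR('a alg_closure)" by simp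
  have p1: "p > 1" using prime_gt_1_nat[OF pr] by (simp add: p_def)
  have e0: "e > 0"
    using card_mono[of UNIV "{0, 1::'a}"] assms(1) by (cases e) auto
  define E where "E j = cubic_sum (e * 2 ^ j) (to_ac a) (to_ac b)" for j
  define Q where "Q j = real p ^ (e * 2 ^ j)" for j
  \<comment> \<open>The sum over the field with \<open>q ^ (2 ^ j)\<close> elements, normalised by
    the square root of the order of that field.\<close>
  define v where "v j = norm (E j) / sqrt (Q j)" for j
  have Q0: "Q j > 0" for j using p1 by (simp add: Q_def)
  have QS: "Q (Suc j) = (Q j)\<^sup>2" for j by (simp add: Q_def mult_ac flip: power_mult)
  have ac: "to_ac c \<in> frob_fixed (e * n)" for c :: 'a and n
    using finite_field_power_card[of c]
    by (intro frob_fixed_mult_exponent) (simp add: frob_fixed_def assms(1) flip: to_ac_power)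
  have rec: "E (Suc j) = 2 * of_real (Q j) - (E j)\<^sup>2" for j
    using cubic_sum_double[OF pr', of "e * 2 ^ j" "to_ac a" "to_ac b"] assms e0 ac
    by (simp add: E_def Q_def p_def mult.assoc mult.commute[of 2])
  have step: "v (Suc j) \<ge> (v j)\<^sup>2 - 2" for j
  proof -
    have "norm (E j) ^ 2 = norm (2 * of_real (Q j) - E (Suc j))" by (simp add: rec norm_power)
    also have "\<dots> \<le> 2 * Q j + norm (E (Suc j))"
      using norm_triangle_ineq4[of "2 * of_real (Q j)" "E (Suc j)"] Q0[of j]
      by (simp add: norm_mult)
    finally have "norm (E j) ^ 2 / Q j \<le> (2 * Q j + norm (E (Suc j))) / Q j"
      by (intro divide_right_mono) (use Q0[of j] in auto)
    thus ?thesis using Q0[of j] by (simp add: v_def QS power_divide add_divide_distrib)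
  qed
  \<comment> \<open>The fibre bound concerns fields of even degree \<open>l * 2\<close> over the
    prime field, hence the index \<open>Suc j\<close> with \<open>l = e * 2 ^ j\<close>.\<close>
  have bound: "v (Suc j) \<le> 8 * real p" for j
  proof -
    have "norm (E (Suc j)) \<le> 8 * real p * Q j"
      using norm_cubic_sum_double_le[OF assms, of "e * 2 ^ j" b] e0
      by (simp add: E_def Q_def p_def mult.assoc mult.commute[of 2])
    thus ?thesis using Q0[of j] by (simp add: v_def QS field_simps)
  qed
  have "v 0 \<le> 2"
  proof (rule ccontr)
    assume "\<not> v 0 \<le> 2"
    hence v0: "v 0 > 2" by simp
    obtain n where n: "8 * real p / (v 0 - 2) < 4 ^ n" using real_arch_pow[of 4] by auto
    have "8 * real p < 4 ^ n * (v 0 - 2)" using n v0 by (simp add: field_simps)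
    also have "\<dots> \<le> 4 ^ Suc n * (v 0 - 2)" using v0 by (intro mult_right_mono) auto
    also have "\<dots> \<le> v (Suc n)" using square_minus_two_growth[of v "Suc n", OF step] v0 by simp
    finally show False using bound[of n] by simp
  qed
  hence "norm (E 0) \<le> 2 * sqrt (Q 0)" using Q0[of 0] by (simp add: v_def field_simps)
  thus ?thesis by (simp add: E_def Q_def assms(1) p_def)
qed

section \<open>Passage between the finite field and its algebraic closure\<close>

lemma frob_fixed_eq_UNIV:
  assumes "CARD('a::{field,finite}) = CHAR('a) ^ e"
  shows "frob_fixed e = (UNIV :: 'a set)"
  using finite_field_power_card[where ?'a = 'a] by (auto simp: frob_fixed_def assms[symmetric])

lemma expsum_eq_sum_add_char: "expsum e f = (\<Sum>x\<in>UNIV. add_char e (f x))"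
  by (simp add: expsum_def add_char_def prime_char_def prime_field_rep_def fftrace_def trace_sum_def)

text \<open>\<open>to_ac\<close> is injective and preserves sums, powers and \<open>of_nat\<close>,
  so the description operator selects the same representative on both sides.\<close>

lemma add_char_to_ac: "add_char m (to_ac x) = add_char m x"
  by (simp add: add_char_def prime_char_def trace_sum_def
      flip: to_ac_of_nat to_ac_power to_ac_sum)

text \<open>The image of \<open>to_ac\<close> has \<open>p ^ e\<close> elements and lies in
  \<open>frob_fixed e\<close>, which has no more; the two coincide and the sum can be
  reindexed.\<close>

lemma expsum_cubic_eq_cubic_sum:
  fixes a b :: "'a::{field,finite}"
  assumes "CARD('a) = CHAR('a) ^ e"
  shows "expsum e (\<lambda>x. a * x ^ 3 + b * x) = cubic_sum e (to_ac a) (to_ac b)"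
proof -
  have pr: "prime CHAR('a alg_closure)" using prime_CHAR_finite_field[where ?'a = 'a] by simp
  have e0: "e > 0"
    using card_mono[of UNIV "{0, 1::'a}"] assms by (cases e) auto
  have "range to_ac \<subseteq> (frob_fixed e :: 'a alg_closure set)"
    using finite_field_power_card[where ?'a = 'a]
    by (auto simp: frob_fixed_def assms[symmetric] simp flip: to_ac_power)
  moreover have "card (frob_fixed e :: 'a alg_closure set) \<le> card (range (to_ac :: 'a \<Rightarrow> _))"
    using frob_fixed_finite(2)[OF pr e0] by (simp add: card_image inj_to_ac assms)
  ultimately have "range to_ac = (frob_fixed e :: 'a alg_closure set)"
    by (rule card_seteq[OF frob_fixed_finite(1)[OF pr e0]])
  hence bij: "bij_betw to_ac (UNIV :: 'a set) (frob_fixed e)"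
    by (simp add: bij_betw_def inj_to_ac)
  show ?thesis
    unfolding cubic_sum_def expsum_eq_sum_add_char sum.reindex_bij_betw[OF bij, symmetric]
    by (simp add: add_char_to_ac flip: to_ac_mult to_ac_power to_ac_add)
qed

section \<open>Spectra of graphs from orthogonal eigenvectors\<close>

text \<open>The vectors \<open>Y w\<close> are the columns of a matrix \<open>P\<close> whose
  inverse is, by orthogonality, its conjugate transpose divided by \<open>card V\<close>. So the
  complexified adjacency matrix is similar to a diagonal one, and the factorisation of its
  characteristic polynomial descends to the reals.\<close>

lemma adj_eigenvalues_eqI:
  fixes Y :: "'v \<Rightarrow> 'v \<Rightarrow> complex" and ev :: "'v \<Rightarrow> real"
  assumes fin: "finite V" and ne: "V \<noteq> {}"
    and eig: "\<And>w a. w \<in> V \<Longrightarrow> a \<in> V \<Longrightarrow> (\<Sum>b\<in>{b\<in>V. E a b}. Y w b) = of_real (ev w) * Y w a"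
    and orth: "\<And>w w'. w \<in> V \<Longrightarrow> w' \<in> V \<Longrightarrow>
      (\<Sum>v\<in>V. cnj (Y w v) * Y w' v) = (if w = w' then of_nat (card V) else 0)"
  shows "adj_eigenvalues V E = image_mset ev (mset_set V)"
proof -
  interpret of_real_poly_hom: map_poly_inj_idom_hom "of_real :: real \<Rightarrow> complex" ..
  define n where "n = card V"
  define e where "e = vert_enum V"
  have n0: "n > 0" using fin ne by (simp add: n_def card_gt_0_iff)
  have "\<exists>h. bij_betw h {..<card V} V"
    using ex_bij_betw_nat_finite[OF fin] by (simp add: lessThan_atLeast0)
  hence e: "bij_betw e {..<n} V" unfolding e_def vert_enum_def n_def by (rule someI_ex)
  have eV: "e i \<in> V" if "i < n" for i using bij_betwE[OF e] that by auto
  have inj: "e i = e j \<longleftrightarrow> i = j" if "i < n" "j < n" for i j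
    using bij_betw_imp_inj_on[OF e] that by (auto dest: inj_onD)
  have reindex: "(\<Sum>i<n. g (e i)) = (\<Sum>v\<in>V. g v)" for g :: "'v \<Rightarrow> complex"
    by (rule sum.reindex_bij_betw[OF e])
  define A where "A = adj_matrix V E"
  define AC where "AC = map_mat complex_of_real A"
  define P where "P = mat n n (\<lambda>(i, j). Y (e j) (e i))"
  define Q where "Q = mat n n (\<lambda>(i, j). cnj (Y (e i) (e j)) / of_nat n)"
  define D where "D = mat n n (\<lambda>(i, j). if i = j then complex_of_real (ev (e i)) else 0)"
  have A: "A \<in> carrier_mat n n" by (simp add: A_def adj_matrix_def n_def)
  have AC: "AC \<in> carrier_mat n n" using A by (simp add: AC_def)
  have P: "P \<in> carrier_mat n n" and Q: "Q \<in> carrier_mat n n" and D: "D \<in> carrier_mat n n"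
    by (simp_all add: P_def Q_def D_def)
  have QP: "Q * P = 1\<^sub>m n"
  proof (rule eq_matI)
    fix i j assume "i < dim_row (1\<^sub>m n)" "j < dim_col (1\<^sub>m n :: complex mat)"
    hence ij: "i < n" "j < n" by auto
    have "(Q * P) $$ (i, j) = (\<Sum>k<n. cnj (Y (e i) (e k)) / of_nat n * Y (e j) (e k))"
      using ij by (simp add: P_def Q_def scalar_prod_def lessThan_atLeast0)
    also have "\<dots> = (\<Sum>v\<in>V. cnj (Y (e i) v) * Y (e j) v) / of_nat n"
      by (simp add: reindex[symmetric] sum_divide_distrib)
    also have "\<dots> = 1\<^sub>m n $$ (i, j)" using ij n0 by (simp add: orth eV inj n_def)
    finally show "(Q * P) $$ (i, j) = 1\<^sub>m n $$ (i, j)" .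
  qed (use P Q in auto)
  have PQ: "P * Q = 1\<^sub>m n" by (rule mat_mult_left_right_inverse[OF Q P QP])
  have AP: "AC * P = P * D"
  proof (rule eq_matI)
    fix i j assume "i < dim_row (P * D)" "j < dim_col (P * D)"
    hence ij: "i < n" "j < n" using P D by auto
    have "(AC * P) $$ (i, j) = (\<Sum>k<n. (if E (e i) (e k) then 1 else 0) * Y (e j) (e k))"
      using ij by (auto simp: P_def AC_def A_def adj_matrix_def scalar_prod_def lessThan_atLeast0
          e_def[symmetric] n_def[symmetric] intro!: sum.cong)
    also have "\<dots> = (\<Sum>v\<in>V. (if E (e i) v then 1 else 0) * Y (e j) v)"
      by (rule reindex)
    also have "\<dots> = (\<Sum>v\<in>{v\<in>V. E (e i) v}. Y (e j) v)"
      by (rule sum.mono_neutral_cong_right) (use fin in auto)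
    also have "\<dots> = Y (e j) (e i) * of_real (ev (e j))" using ij by (simp add: eig eV)
    also have "\<dots> = (\<Sum>k<n. if k = j then Y (e k) (e i) * of_real (ev (e j)) else 0)"
      using ij by simp
    also have "\<dots> = (\<Sum>k<n. Y (e k) (e i) * (if k = j then of_real (ev (e k)) else 0))"
      by (intro sum.cong) auto
    also have "\<dots> = (P * D) $$ (i, j)"
      using ij by (simp add: P_def D_def scalar_prod_def lessThan_atLeast0)
    finally show "(AC * P) $$ (i, j) = (P * D) $$ (i, j)" .
  qed (use P AC D in auto)
  have "AC = AC * (P * Q)" using AC PQ by simp
  also have "\<dots> = P * D * Q" using AC P Q D AP by (simp flip: assoc_mult_mat)
  finally have "similar_mat AC D"
    by (intro similar_matI[of _ _ P Q n]) (use AC P Q D PQ QP in auto)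
  hence "char_poly AC = char_poly D" by (rule char_poly_similar)
  also have "\<dots> = (\<Prod>a\<leftarrow>diag_mat D. [:- a, 1:])"
    by (rule char_poly_upper_triangular[OF D]) (auto simp: D_def)
  also have "diag_mat D = map (\<lambda>i. complex_of_real (ev (e i))) [0..<n]"
    by (auto simp: diag_mat_def D_def)
  also have "(\<Prod>a\<leftarrow>map (\<lambda>i. complex_of_real (ev (e i))) [0..<n]. [:- a, 1:])
      = (\<Prod>i<n. [:- complex_of_real (ev (e i)), 1:])"
    by (simp add: o_def prod.distinct_set_conv_list[symmetric] lessThan_atLeast0)
  also have "\<dots> = map_poly complex_of_real (\<Prod>i<n. [:- ev (e i), 1:])"
    by (simp add: of_real_poly_hom.hom_prod)
  finally have "map_poly complex_of_real (char_poly A) = map_poly complex_of_real (\<Prod>i<n. [:- ev (e i), 1:])"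
    unfolding AC_def by (simp add: of_real_hom.char_poly_hom[OF A])
  hence "char_poly A = (\<Prod>i<n. [:- ev (e i), 1:])"
    by (simp only: of_real_poly_hom.eq_iff)
  hence "adj_eigenvalues V E = (\<Sum>i<n. {#ev (e i)#})"
    unfolding adj_eigenvalues_def A_def[symmetric] by (simp add: proots_prod)
  also have "\<dots> = image_mset ev (image_mset e (mset_set {..<n}))"
    by (induction n) (auto simp: lessThan_Suc)
  also have "image_mset e (mset_set {..<n}) = mset_set V"
    using e by (simp add: image_mset_mset_set bij_betw_def)
  finally show ?thesis .
qed

text \<open>Removing one copy of the maximum amounts to removing the index \<open>z\<close>; copies
  of the maximum at other indices are kept.\<close>

lemma lambda2_eqI:
  assumes "finite V" "adj_eigenvalues V E = image_mset ev (mset_set V)" "z \<in> V"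
    and "\<And>w. w \<in> V \<Longrightarrow> ev w \<le> ev z"
    and "\<And>w. w \<in> V \<Longrightarrow> w \<noteq> z \<Longrightarrow> ev w \<le> c"
    and "w0 \<in> V" "w0 \<noteq> z" "ev w0 = c"
  shows "lambda2 V E = c"
proof -
  have eq: "adj_eigenvalues V E = add_mset (ev z) (image_mset ev (mset_set (V - {z})))"
    using assms(1-3) by (simp add: mset_set.remove)
  have mx: "Max_mset (adj_eigenvalues V E) = ev z"
    unfolding assms(2) by (rule Max_eqI) (use assms in auto)
  have "lambda2 V E = Max_mset (image_mset ev (mset_set (V - {z})))"
    unfolding lambda2_def Let_def mx unfolding eq by simp
  also have "\<dots> = c" by (rule Max_eqI) (use assms in auto)
  finally show ?thesis .
qed

section \<open>The Cayley graph\<close>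

definition graph_char :: "nat \<Rightarrow> nat \<Rightarrow> (nat \<Rightarrow> 'a::{field,finite}) \<Rightarrow> (nat \<Rightarrow> 'a) \<Rightarrow> complex" where
  "graph_char e k w v = add_char e (\<Sum>i=1..k. w i * v i)"

text \<open>The connection set of the Cayley graph, parametrised by the difference \<open>x\<close>
  of the first coordinates and the quotient \<open>y\<close> of the second difference by the
  first.\<close>

definition graph_step :: "nat \<Rightarrow> 'a::{field,finite} \<Rightarrow> 'a \<Rightarrow> nat \<Rightarrow> 'a" where
  "graph_step k x y i = (if i = 1 then x else if i = 2 then x * y
     else if 3 \<le> i \<and> i \<le> k then x ^ 3 * y ^ (i - 1) else 0)"

text \<open>For fixed \<open>y\<close>, the pairing of \<open>w\<close> with
  \<open>graph_step k x y\<close> is a polynomial in \<open>x\<close>; this is its coefficient at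
  \<open>x\<close>, and \<open>cub_part\<close> is the one at \<open>x ^ 3\<close>.\<close>

definition lin_part :: "(nat \<Rightarrow> 'a::{field,finite}) \<Rightarrow> 'a \<Rightarrow> 'a" where
  "lin_part w y = w 1 + w 2 * y"

definition cub_part :: "nat \<Rightarrow> (nat \<Rightarrow> 'a::{field,finite}) \<Rightarrow> 'a \<Rightarrow> 'a" where
  "cub_part k w y = (\<Sum>i=3..k. w i * y ^ (i - 1))"

abbreviation cubic_adj :: "nat \<Rightarrow> (nat \<Rightarrow> 'a::{field,finite}) \<Rightarrow> (nat \<Rightarrow> 'a) \<Rightarrow> bool" where
  "cubic_adj k \<equiv> S_adj k (\<lambda>i x. x ^ (i - 1)) (\<lambda>i x. x ^ 3)"

context
  fixes e k :: nat and max_sum :: real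
  assumes card_eq: "CARD('a::{field,finite}) = CHAR('a) ^ e"
    and odd_card: "odd CARD('a)"
    and card_mod_3: "CARD('a) mod 3 = 2"
    and k_ge_4: "4 \<le> k" and k_le: "k \<le> CARD('a) + 1"
    and max_sum_def: "max_sum = Max {Re (expsum e (\<lambda>x::'a. a * x ^ 3 + b * x)) | a b. a \<noteq> 0 \<and> b \<noteq> 0}"
begin

abbreviation "V \<equiv> S_verts k :: (nat \<Rightarrow> 'a) set"
abbreviation "psi \<equiv> add_char e :: 'a \<Rightarrow> complex"
abbreviation "C \<equiv> cubic_sum e :: 'a \<Rightarrow> 'a \<Rightarrow> complex"
abbreviation "chi \<equiv> graph_char e k :: (nat \<Rightarrow> 'a) \<Rightarrow> (nat \<Rightarrow> 'a) \<Rightarrow> complex"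

text \<open>Each \<open>C\<close> is a complete sum over \<open>x\<close>; the subtracted
  \<open>CARD('a)\<close> removes the forbidden value \<open>x = 0\<close>, which contributes 1 for
  every \<open>y\<close>.\<close>

definition eigval :: "(nat \<Rightarrow> 'a) \<Rightarrow> real" where
  "eigval w = (\<Sum>y\<in>UNIV. Re (C (cub_part k w y) (lin_part w y))) - real CARD('a)"

section \<open>Cubic sums over the base field\<close>

lemma prime_char_field: "prime CHAR('a)" by (rule prime_CHAR_finite_field)

lemma e_pos: "e > 0"
  using card_mono[of UNIV "{0, 1::'a}"] card_eq by (cases e) auto

lemma char_not_2: "CHAR('a) \<noteq> 2"
  using odd_card card_eq e_pos by auto

lemma char_not_3: "CHAR('a) \<noteq> 3"
  using card_mod_3 card_eq e_pos by (cases e) auto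

lemma q_ge_5: "CARD('a) \<ge> 5"
  using odd_card card_mod_3 by presburger

lemma fixed_UNIV: "frob_fixed e = (UNIV :: 'a set)"
  by (rule frob_fixed_eq_UNIV[OF card_eq])

lemma psi_add: "psi (x + y) = psi x * psi y"
  by (rule add_char_add[OF prime_char_field]) (simp_all add: fixed_UNIV)

lemma psi_0 [simp]: "psi 0 = 1" by (rule add_char_0[OF prime_char_field])

lemma psi_minus: "psi (- x) = cnj (psi x)"
  by (rule add_char_minus[OF prime_char_field]) (simp add: fixed_UNIV)

lemma psi_sum: "(\<Sum>x\<in>UNIV. psi (c * x)) = (if c = 0 then of_nat CARD('a) else 0)"
  using sum_add_char[OF prime_char_field e_pos _, of c] by (simp add: fixed_UNIV card_eq)

lemma C_eq: "C a b = (\<Sum>x\<in>UNIV. psi (a * x ^ 3 + b * x))"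
  by (simp add: cubic_sum_def fixed_UNIV)

text \<open>With \<open>q = 3 * j + 2\<close>, the exponent \<open>2 * j + 1\<close> undoes cubing,
  because \<open>3 * (2 * j + 1) = q + (q - 1)\<close> and \<open>z ^ q = z\<close>.\<close>

lemma cube_inj: "inj (\<lambda>x::'a. x ^ 3)"
proof (rule injI)
  fix x y :: 'a assume eq: "x ^ 3 = y ^ 3"
  define j where "j = CARD('a) div 3"
  have Q: "CARD('a) = 3 * j + 2" unfolding j_def using card_mod_3 by presburger
  have inv: "(z ^ 3) ^ (2 * j + 1) = z" for z :: 'a
  proof -
    have "(z ^ 3) ^ (2 * j + 1) = z ^ (3 * (2 * j + 1))" by (rule power_mult[symmetric])
    also have "3 * (2 * j + 1) = (3 * j + 2) + (3 * j + 1)" by simp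
    also have "z ^ \<dots> = z ^ (3 * j + 2) * z ^ (3 * j + 1)" by (rule power_add)
    also have "z ^ (3 * j + 2) = z" using finite_field_power_card[of z] by (simp only: Q)
    also have "z * z ^ (3 * j + 1) = z ^ (3 * j + 2)" by simp
    also have "\<dots> = z" using finite_field_power_card[of z] by (simp only: Q)
    finally show ?thesis .
  qed
  show "x = y" using inv[of x] inv[of y] eq by simp
qed

lemma cube_bij: "bij (\<lambda>x::'a. x ^ 3)"
  using cube_inj by (simp add: bij_def finite_UNIV_inj_surj)

lemma C_0_0: "C 0 0 = of_nat CARD('a)" by (simp add: C_eq)

lemma C_0_left: "b \<noteq> 0 \<Longrightarrow> C 0 b = 0"
  using psi_sum[of b] by (simp add: C_eq)

lemma C_0_right: "a \<noteq> 0 \<Longrightarrow> C a 0 = 0"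
  using psi_sum[of a] sum.reindex_bij_betw[OF cube_bij, of "\<lambda>x. psi (a * x)"] by (simp add: C_eq)

text \<open>Replacing \<open>x\<close> by \<open>- x\<close> negates the odd polynomial and so
  conjugates every term.\<close>

lemma C_real: "C a b \<in> \<real>"
proof -
  have "cnj (C a b) = (\<Sum>x\<in>UNIV. psi (a * (- x) ^ 3 + b * (- x)))"
    by (simp add: C_eq flip: psi_minus)
  also have "\<dots> = C a b"
    unfolding C_eq by (rule sum.reindex_bij_witness[of _ uminus uminus]) auto
  finally show ?thesis by (simp add: complex_cnj_cancel_iff Reals_cnj_iff)
qed

lemma norm_C_le: "norm (C a b) \<le> real CARD('a)"
  unfolding C_eq by (rule order.trans[OF norm_sum]) simp

lemma Re_C_le: "Re (C a b) \<le> real CARD('a)"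
  using norm_C_le[of a b] complex_Re_le_cmod[of "C a b"] by linarith

lemma C_scale: "y \<noteq> 0 \<Longrightarrow> C (a * y ^ 3) (b * y) = C a b"
  unfolding C_eq
  by (rule sum.reindex_bij_witness[of _ "\<lambda>x. x / y" "\<lambda>x. y * x"]) (auto simp: power_mult_distrib mult_ac)

lemma max_sum_eq: "max_sum = Max ((\<lambda>(a, b). Re (C a b)) ` ((UNIV - {0}) \<times> (UNIV - {0})))"
proof -
  have "{Re (expsum e (\<lambda>x::'a. a * x ^ 3 + b * x)) | a b. a \<noteq> 0 \<and> b \<noteq> 0}
      = (\<lambda>(a, b). Re (C a b)) ` ((UNIV - {0}) \<times> (UNIV - {0}))"
    by (auto simp: expsum_eq_sum_add_char C_eq image_iff)
  thus ?thesis by (simp only: max_sum_def)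
qed

lemma max_sum_ge: "a \<noteq> 0 \<Longrightarrow> b \<noteq> 0 \<Longrightarrow> Re (C a b) \<le> max_sum"
  unfolding max_sum_eq by (rule Max_ge) auto

lemma max_sum_attained: obtains a b where "a \<noteq> 0" "b \<noteq> 0" "Re (C a b) = max_sum"
proof -
  have "max_sum \<in> (\<lambda>(a, b). Re (C a b)) ` ((UNIV - {0}) \<times> (UNIV - {0}))"
    unfolding max_sum_eq
  proof (rule Max_in)
    have "(1, 1) \<in> (UNIV - {0::'a}) \<times> (UNIV - {0::'a})" by simp
    thus "(\<lambda>(a, b). Re (C a b)) ` ((UNIV - {0}) \<times> (UNIV - {0})) \<noteq> {}" by blast
  qed simp
  thus ?thesis using that by auto
qed

text \<open>By orthogonality the sum of all \<open>C 1 b\<close> is \<open>q\<close>, while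
  \<open>C 1 0\<close> vanishes, so some \<open>C 1 b\<close> with \<open>b \<noteq> 0\<close> has
  positive real part. Positivity lets \<open>max_sum\<close> also dominate those sums that are
  0.\<close>

lemma max_sum_pos: "max_sum > 0"
proof (rule ccontr)
  assume "\<not> max_sum > 0"
  hence "(\<Sum>b\<in>UNIV - {0}. Re (C 1 b)) \<le> 0"
    by (intro sum_nonpos) (use max_sum_ge[of 1] in fastforce)
  moreover have "(\<Sum>b\<in>UNIV. Re (C 1 b)) = Re (C 1 0) + (\<Sum>b\<in>UNIV - {0}. Re (C 1 b))"
    by (rule sum.remove) auto
  moreover have "(\<Sum>b\<in>UNIV. C 1 b) = of_nat CARD('a)"
  proof -
    have "(\<Sum>b\<in>UNIV. C 1 b) = (\<Sum>x\<in>UNIV. \<Sum>b\<in>UNIV. psi (x ^ 3) * psi (x * b))"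
      unfolding C_eq by (subst sum.swap) (simp add: psi_add mult.commute)
    also have "\<dots> = (\<Sum>x\<in>UNIV. if x = (0::'a) then of_nat CARD('a) else 0)"
      by (simp only: sum_distrib_left[symmetric] psi_sum) (rule sum.cong, auto)
    finally show ?thesis by simp
  qed
  hence "(\<Sum>b\<in>UNIV. Re (C 1 b)) = real CARD('a)" by (simp flip: Re_sum)
  ultimately show False using C_0_right[of 1] q_ge_5 by simp
qed

lemma max_sum_le: "max_sum \<le> 2 * sqrt (real CARD('a))"
proof -
  obtain a b where ab: "a \<noteq> 0" "b \<noteq> 0" "Re (C a b) = max_sum" by (rule max_sum_attained)
  have "C a b = cubic_sum e (to_ac a) (to_ac b)"
    using expsum_cubic_eq_cubic_sum[OF card_eq, of a b] by (simp add: expsum_eq_sum_add_char C_eq)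
  hence "norm (C a b) \<le> 2 * sqrt (real CARD('a))"
    using norm_cubic_sum_le[OF card_eq char_not_2 char_not_3 ab(1), of b] by simp
  thus ?thesis using ab(3) complex_Re_le_cmod[of "C a b"] by linarith
qed

lemma max_sum_less: "max_sum < real CARD('a)"
proof -
  have "sqrt (real CARD('a)) > 2" using q_ge_5 by (intro real_less_rsqrt) simp
  hence "2 * sqrt (real CARD('a)) < sqrt (real CARD('a)) * sqrt (real CARD('a))" by (intro mult_strict_right_mono) auto
  thus ?thesis using max_sum_le by simp
qed

section \<open>Characters of the vector space as eigenvectors\<close>

lemma finite_V: "finite V"
proof -
  have "V = {f. \<forall>i. (i \<in> {1..k} \<longrightarrow> f i \<in> UNIV) \<and> (i \<notin> {1..k} \<longrightarrow> f i = 0)}"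
    by (auto simp: S_verts_def)
  thus ?thesis by (simp only: finite_set_of_finite_funs finite_atLeastAtMost finite_class.finite_UNIV)
qed

lemma V_add: "v \<in> V \<Longrightarrow> w \<in> V \<Longrightarrow> (\<lambda>i. v i + w i) \<in> V"
  and V_diff: "v \<in> V \<Longrightarrow> w \<in> V \<Longrightarrow> (\<lambda>i. v i - w i) \<in> V"
  and V_zero: "(\<lambda>_. 0) \<in> V"
  by (auto simp: S_verts_def)

lemma chi_add: "chi w (\<lambda>i. u i + v i) = chi w u * chi w v"
  by (simp add: graph_char_def distrib_left sum.distrib psi_add)

lemma chi_commute: "chi w v = chi v w"
  by (simp add: graph_char_def mult.commute)

lemma chi_orthogonal:
  assumes "w \<in> V" "w' \<in> V"
  shows "(\<Sum>v\<in>V. cnj (chi w v) * chi w' v) = (if w = w' then of_nat (card V) else 0)"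
proof -
  have eq: "cnj (chi w v) * chi w' v = psi (\<Sum>i=1..k. (w' i - w i) * v i)" for v
    by (simp add: graph_char_def left_diff_distrib sum_subtractf flip: psi_minus psi_add)
  show ?thesis
  proof (cases "w = w'")
    case False
    then obtain i where i: "w i \<noteq> w' i" by auto
    have ik: "i \<in> {1..k}"
    proof (rule ccontr)
      assume "i \<notin> {1..k}"
      hence "w i = 0" "w' i = 0" using assms unfolding S_verts_def by blast+
      thus False using i by simp
    qed
    define S where "S = (\<Sum>v\<in>V. cnj (chi w v) * chi w' v)"
    obtain z where z: "psi z \<noteq> 1"
    proof (rule ccontr)
      assume "\<not> thesis"
      hence "psi x = 1" for x using that by blast
      thus False using psi_sum[of 1] by simp
    qed
    define d where "d = (\<lambda>j. if j = i then z / (w' i - w i) else 0)"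
    have d: "d \<in> V" using ik by (auto simp: d_def S_verts_def)
    have dz: "(\<Sum>j=1..k. (w' j - w j) * d j) = z"
    proof -
      have "(\<Sum>j=1..k. (w' j - w j) * d j) = (\<Sum>j=1..k. if j = i then z else 0)"
        using i by (intro sum.cong) (auto simp: d_def)
      thus ?thesis using ik by simp
    qed
    have "S = (\<Sum>v\<in>V. psi (\<Sum>j=1..k. (w' j - w j) * (v j + d j)))"
      unfolding S_def eq
      by (rule sum.reindex_bij_witness[of _ "\<lambda>v j. v j + d j" "\<lambda>v j. v j - d j"])
        (auto intro: V_add V_diff d)
    also have "\<dots> = (\<Sum>v\<in>V. psi z * psi (\<Sum>j=1..k. (w' j - w j) * v j))"
      by (simp only: distrib_left sum.distrib dz psi_add mult.commute[of _ "psi z"])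
    also have "\<dots> = psi z * S" by (simp add: S_def eq sum_distrib_left)
    finally show ?thesis using z False by (simp add: S_def)
  next
    case True
    show ?thesis unfolding eq by (simp add: True)
  qed
qed

lemma step_in_V: "graph_step k x y \<in> V"
  using k_ge_4 by (auto simp: graph_step_def S_verts_def)

lemma adj_iff:
  "cubic_adj k a b \<longleftrightarrow> a \<in> V \<and> (\<exists>x y. x \<noteq> 0 \<and> b = (\<lambda>i. a i + graph_step k x y i))"
proof
  assume *: "cubic_adj k a b"
  define x where "x = b 1 - a 1"
  define y where "y = (b 2 - a 2) / x"
  have x0: "x \<noteq> 0" using * by (auto simp: S_adj_def x_def)
  have "b i = a i + graph_step k x y i" for i
  proof -
    consider "i = 1" | "i = 2" | "3 \<le> i" "i \<le> k" | "i \<notin> {1..k}" using k_ge_4 by force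
    thus ?thesis
    proof cases
      case 3
      hence "b i - a i = x ^ 3 * y ^ (i - 1)" using * by (auto simp: S_adj_def x_def y_def)
      thus ?thesis using 3 by (simp add: graph_step_def algebra_simps)
    next
      case 4
      thus ?thesis using * k_ge_4 by (auto simp: S_adj_def S_verts_def graph_step_def)
    qed (use x0 in \<open>simp_all add: graph_step_def x_def y_def\<close>)
  qed
  thus "a \<in> V \<and> (\<exists>x y. x \<noteq> 0 \<and> b = (\<lambda>i. a i + graph_step k x y i))"
    using * x0 by (auto simp: S_adj_def)
next
  assume "a \<in> V \<and> (\<exists>x y. x \<noteq> 0 \<and> b = (\<lambda>i. a i + graph_step k x y i))"
  then obtain x y where "a \<in> V" "x \<noteq> 0" "b = (\<lambda>i. a i + graph_step k x y i)" by auto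
  moreover from this have "b \<in> V" using V_add[OF _ step_in_V] by simp
  ultimately show "cubic_adj k a b" by (auto simp: S_adj_def graph_step_def)
qed

lemma chi_step: "chi w (graph_step k x y) = psi (cub_part k w y * x ^ 3 + lin_part w y * x)"
proof -
  have "{1..k} = {1, 2} \<union> {3..k}" using k_ge_4 by auto
  hence "(\<Sum>i=1..k. w i * graph_step k x y i)
      = (\<Sum>i\<in>{1, 2}. w i * graph_step k x y i) + (\<Sum>i=3..k. w i * graph_step k x y i)"
    by (simp only:) (rule sum.union_disjoint, auto)
  also have "(\<Sum>i\<in>{1, 2}. w i * graph_step k x y i) = lin_part w y * x"
    by (simp add: graph_step_def lin_part_def algebra_simps)
  also have "(\<Sum>i=3..k. w i * graph_step k x y i) = cub_part k w y * x ^ 3"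
    unfolding cub_part_def sum_distrib_right
    by (intro sum.cong) (auto simp: graph_step_def)
  finally show ?thesis by (simp add: graph_char_def add.commute)
qed

lemma sum_chi_steps: "(\<Sum>x\<in>UNIV - {0}. \<Sum>y\<in>UNIV. chi w (graph_step k x y)) = of_real (eigval w)"
proof -
  have "(\<Sum>x\<in>UNIV - {0}. \<Sum>y\<in>UNIV. chi w (graph_step k x y))
      = (\<Sum>y\<in>UNIV. \<Sum>x\<in>UNIV - {0}. psi (cub_part k w y * x ^ 3 + lin_part w y * x))"
    by (subst sum.swap) (simp only: chi_step)
  also have "\<dots> = (\<Sum>y\<in>UNIV. C (cub_part k w y) (lin_part w y) - 1)"
    unfolding C_eq by (intro sum.cong refl) (simp add: sum_diff1)
  also have "\<dots> = (\<Sum>y\<in>UNIV. of_real (Re (C (cub_part k w y) (lin_part w y))) - 1)"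
    by (simp add: of_real_Re C_real)
  also have "\<dots> = of_real (eigval w)" by (simp add: eigval_def sum_subtractf)
  finally show ?thesis .
qed

text \<open>By additivity of the character, the sum over the neighbours of \<open>a\<close> splits
  into \<open>chi w a\<close> and a sum over steps. Distinct pairs \<open>(x, y)\<close> give
  distinct neighbours, as the first two coordinates recover \<open>x\<close> and then
  \<open>y\<close>.\<close>

lemma chi_eigen:
  assumes "a \<in> V"
  shows "(\<Sum>b\<in>{b\<in>V. cubic_adj k a b}. chi w b) = of_real (eigval w) * chi w a"
proof -
  define h where "h = (\<lambda>(x, y) i. a i + graph_step k x y i)"
  have inj: "inj_on h ((UNIV - {0}) \<times> UNIV)"
  proof (rule inj_onI, safe)
    fix x y x' y' assume *: "x \<noteq> (0::'a)" "h (x, y) = h (x', y')"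
    show x: "x = x'" using fun_cong[OF *(2), of 1] by (simp add: h_def graph_step_def)
    show "y = y'" using fun_cong[OF *(2), of 2] * x by (simp add: h_def graph_step_def)
  qed
  have img: "{b\<in>V. cubic_adj k a b} = h ` ((UNIV - {0}) \<times> UNIV)"
    unfolding adj_iff h_def using assms V_add[OF assms step_in_V] by (auto simp: image_iff)
  have "(\<Sum>b\<in>{b\<in>V. cubic_adj k a b}. chi w b)
      = (\<Sum>z\<in>(UNIV - {0}) \<times> UNIV. chi w a * chi w (graph_step k (fst z) (snd z)))"
    unfolding img by (subst sum.reindex[OF inj]) (simp add: h_def case_prod_beta chi_add)
  also have "\<dots> = chi w a * (\<Sum>x\<in>UNIV - {0}. \<Sum>y\<in>UNIV. chi w (graph_step k x y))"
    by (simp add: sum_distrib_left sum.cartesian_product case_prod_beta)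
  finally show ?thesis by (simp add: sum_chi_steps)
qed

lemma spectrum: "adj_eigenvalues V (cubic_adj k) = image_mset eigval (mset_set V)"
  by (rule adj_eigenvalues_eqI[where Y = chi])
    (use finite_V V_zero chi_eigen chi_orthogonal in auto)

section \<open>Bounds for the eigenvalues and characters that attain them\<close>

lemma eigval_zero: "eigval (\<lambda>_. 0) = real CARD('a) * real CARD('a) - real CARD('a)"
  by (simp add: eigval_def cub_part_def lin_part_def C_0_0)

lemma eigval_le: "eigval w \<le> real CARD('a) * real CARD('a) - real CARD('a)"
  using sum_mono[of UNIV "\<lambda>y. Re (C (cub_part k w y) (lin_part w y))" "\<lambda>_. real CARD('a)"] Re_C_le
  by (simp add: eigval_def)

text \<open>The exponents \<open>i - 1\<close> start at 2, so \<open>y\<^sup>2\<close> splits off;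
  it contributes the zero 0 in addition to the roots of \<open>P\<close>.\<close>

lemma cub_part_poly:
  assumes "\<And>i. i \<in> {3..k} \<Longrightarrow> w i = coeff P (i - 3)" "degree P \<le> k - 3"
  shows "cub_part k w y = y\<^sup>2 * poly P y"
proof -
  have "cub_part k w y = (\<Sum>i=3..k. y\<^sup>2 * (coeff P (i - 3) * y ^ (i - 3)))"
    unfolding cub_part_def
  proof (intro sum.cong refl)
    fix i assume i: "i \<in> {3..k}"
    hence "i - 1 = 2 + (i - 3)" by auto
    hence "y ^ (i - 1) = y\<^sup>2 * y ^ (i - 3)" by (metis power_add)
    thus "w i * y ^ (i - 1) = y\<^sup>2 * (coeff P (i - 3) * y ^ (i - 3))" using assms(1)[OF i] by simp
  qed
  also have "\<dots> = (\<Sum>i\<le>k - 3. y\<^sup>2 * (coeff P i * y ^ i))"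
    by (rule sum.reindex_bij_witness[of _ "\<lambda>i. i + 3" "\<lambda>i. i - 3"]) (use k_ge_4 in auto)
  also have "\<dots> = y\<^sup>2 * poly P y"
    unfolding poly_altdef sum_distrib_left
    by (rule sum.mono_neutral_right) (use assms(2) in \<open>auto simp: coeff_eq_0\<close>)
  finally show ?thesis .
qed

lemma eigval_lin_part_zero:
  assumes "w 1 = 0" "w 2 = 0"
  shows "eigval w = real CARD('a) * real (card {y. cub_part k w y = 0}) - real CARD('a)"
proof -
  have "(\<Sum>y\<in>UNIV. Re (C (cub_part k w y) (lin_part w y)))
      = (\<Sum>y\<in>UNIV. if cub_part k w y = 0 then real CARD('a) else 0)"
    by (intro sum.cong) (simp_all only: lin_part_def assms, simp_all add: C_0_0 C_0_right)
  also have "\<dots> = real CARD('a) * real (card {y. cub_part k w y = 0})"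
    by (simp add: sum.If_cases)
  finally show ?thesis by (simp add: eigval_def)
qed

text \<open>The zeros of \<open>cub_part\<close> are 0 and the at most \<open>k - 3\<close> roots of
  the nonzero polynomial \<open>P\<close>; of the resulting \<open>k - 2\<close> multiples of
  \<open>q\<close> one is cancelled by the subtracted \<open>q\<close>.\<close>

lemma eigval_le_of_lin_part_zero:
  assumes "w \<in> V" "w \<noteq> (\<lambda>_. 0)" "w 1 = 0" "w 2 = 0"
  shows "eigval w \<le> real CARD('a) * (real k - 3)"
proof -
  define P where "P = (\<Sum>i\<le>k - 3. monom (w (i + 3)) i)"
  have coeffP: "coeff P i = (if i \<le> k - 3 then w (i + 3) else 0)" for i
    by (simp add: P_def coeff_sum)
  have degP: "degree P \<le> k - 3" by (rule degree_le) (simp add: coeffP)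
  have cub: "cub_part k w y = y\<^sup>2 * poly P y" for y
    by (rule cub_part_poly) (use degP in \<open>auto simp: coeffP\<close>)
  obtain i where i: "w i \<noteq> 0" using assms(2) by auto
  have "i \<in> {1..k}" "i \<noteq> 1" "i \<noteq> 2" using i assms by (auto simp: S_verts_def)
  hence "1 \<le> i \<and> i \<le> k \<and> i \<noteq> 1 \<and> i \<noteq> 2" by simp
  hence "3 \<le> i" "i \<le> k" by presburger+
  hence "coeff P (i - 3) \<noteq> 0" using i by (simp add: coeffP diff_le_mono)
  hence P0: "P \<noteq> 0" by auto
  have "card {y. cub_part k w y = 0} \<le> card (insert 0 {y. poly P y = 0})"
    by (intro card_mono) (auto simp: cub)
  also have "\<dots> \<le> Suc (card {y. poly P y = 0})" by (rule card_insert_le_m1) auto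
  also have "\<dots> \<le> Suc (k - 3)" using card_poly_roots_bound[OF P0] degP by simp
  finally have "real (card {y. cub_part k w y = 0}) \<le> real k - 2" using k_ge_4 by linarith
  hence "real CARD('a) * real (card {y. cub_part k w y = 0}) \<le> real CARD('a) * (real k - 2)"
    by (intro mult_left_mono) auto
  thus ?thesis using eigval_lin_part_zero[OF assms(3,4)] by (simp add: algebra_simps)
qed

text \<open>Away from a single \<open>y0\<close> the linear coefficient is nonzero, so the cubic sum
  is 0 or bounded by \<open>max_sum\<close>; at \<open>y0\<close> the trivial bound \<open>q\<close>
  is compensated by the subtracted \<open>q\<close>.\<close>

lemma eigval_le_of_lin_part_nonzero:
  assumes "w 1 \<noteq> 0 \<or> w 2 \<noteq> 0"
  shows "eigval w \<le> (real CARD('a) - 1) * max_sum"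
proof -
  \<comment> \<open>The only possible zero of \<open>lin_part w\<close>; for \<open>w 2 = 0\<close>
    there is none and 0 is a placeholder.\<close>
  define y0 where "y0 = (if w 2 = 0 then 0 else - w 1 / w 2)"
  have "lin_part w y \<noteq> 0" if "y \<noteq> y0" for y
    using that assms by (auto simp: lin_part_def y0_def field_simps add_eq_0_iff split: if_splits)
  hence "Re (C (cub_part k w y) (lin_part w y)) \<le> max_sum" if "y \<noteq> y0" for y
    using that max_sum_ge[of "cub_part k w y" "lin_part w y"] max_sum_pos C_0_left
    by (cases "cub_part k w y = 0") force+
  hence "(\<Sum>y\<in>UNIV - {y0}. Re (C (cub_part k w y) (lin_part w y))) \<le> (\<Sum>y\<in>UNIV - {y0}. max_sum)"
    by (intro sum_mono) auto
  also have "\<dots> = (real CARD('a) - 1) * max_sum"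
    using q_ge_5 by (simp add: card_Diff_singleton of_nat_diff)
  finally have "(\<Sum>y\<in>UNIV - {y0}. Re (C (cub_part k w y) (lin_part w y))) \<le> (real CARD('a) - 1) * max_sum" .
  moreover have "eigval w = Re (C (cub_part k w y0) (lin_part w y0))
      + (\<Sum>y\<in>UNIV - {y0}. Re (C (cub_part k w y) (lin_part w y))) - real CARD('a)"
    unfolding eigval_def by (subst sum.remove[of _ y0]) auto
  ultimately show ?thesis using Re_C_le[of "cub_part k w y0" "lin_part w y0"] by linarith
qed

lemma eigval_nonzero_le:
  assumes "w \<in> V" "w \<noteq> (\<lambda>_. 0)"
  shows "eigval w \<le> max (real CARD('a) * (real k - 3)) ((real CARD('a) - 1) * max_sum)"
  using eigval_le_of_lin_part_zero[OF assms] eigval_le_of_lin_part_nonzero[of w]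
  by (cases "w 1 = 0 \<and> w 2 = 0") (auto simp: le_max_iff_disj)

text \<open>The witness encodes a monic polynomial with \<open>k - 3\<close> distinct nonzero roots,
  which together with 0 gives exactly \<open>k - 2\<close> zeros. The upper bound on
  \<open>k\<close> ensures that there are enough nonzero elements.\<close>

lemma eigval_attains_linear:
  obtains w where "w \<in> V" "w \<noteq> (\<lambda>_. 0)" "eigval w = real CARD('a) * (real k - 3)"
proof -
  have "k - 3 \<le> card (UNIV - {0::'a})" using k_le q_ge_5 by (simp add: card_Diff_singleton)
  then obtain R where R: "R \<subseteq> UNIV - {0::'a}" "card R = k - 3"
    using obtain_subset_with_card_n by metis
  define P where "P = (\<Prod>z\<in>R. [:- z, 1:])"
  have degP: "degree P = k - 3" by (simp add: P_def degree_prod_eq_sum_degree R(2))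
  have "lead_coeff P = 1" unfolding P_def by (intro monic_prod) auto
  define w where "w i = (if i \<in> {3..k} then coeff P (i - 3) else 0)" for i
  have wV: "w \<in> V" by (auto simp: w_def S_verts_def)
  have "w k = 1" using k_ge_4 \<open>lead_coeff P = 1\<close> by (simp add: w_def degP)
  hence w0: "w \<noteq> (\<lambda>_. 0)" by auto
  have cub: "cub_part k w y = y\<^sup>2 * poly P y" for y
    by (rule cub_part_poly) (use degP in \<open>auto simp: w_def\<close>)
  have "{y. cub_part k w y = 0} = insert 0 R"
    by (auto simp: cub P_def poly_prod)
  moreover have "card (insert 0 R) = k - 2"
    using R k_ge_4 finite_subset[OF R(1)] by (subst card_insert_disjoint) auto
  ultimately have "eigval w = real CARD('a) * real (k - 2) - real CARD('a)"
    using eigval_lin_part_zero[of w] by (simp add: w_def)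
  thus ?thesis using that[OF wV w0] k_ge_4 by (simp add: of_nat_diff algebra_simps)
qed

lemma eigval_attains_max_sum:
  obtains w where "w \<in> V" "w \<noteq> (\<lambda>_. 0)" "eigval w = (real CARD('a) - 1) * max_sum"
proof -
  obtain a b where ab: "a \<noteq> 0" "b \<noteq> 0" "Re (C a b) = max_sum" by (rule max_sum_attained)
  \<comment> \<open>Index 2 carries \<open>y\<close> and index 4 carries \<open>y ^ 3\<close>, so
    each \<open>y \<noteq> 0\<close> contributes the real part of
    \<open>C (a * y ^ 3) (b * y) = C a b\<close>, while \<open>y = 0\<close> contributes the
    \<open>q\<close> that is subtracted.\<close>
  define w where "w i = (if i = 2 then b else if i = 4 then a else 0)" for i :: nat
  have wV: "w \<in> V" using k_ge_4 by (auto simp: w_def S_verts_def)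
  have w0: "w \<noteq> (\<lambda>_. 0)" using ab(2) by (auto simp: w_def dest: fun_cong[of _ _ 2])
  have L: "lin_part w y = b * y" for y by (simp add: lin_part_def w_def)
  have F: "cub_part k w y = a * y ^ 3" for y
  proof -
    have "cub_part k w y = (\<Sum>i=3..k. if i = 4 then a * y ^ 3 else 0)"
      unfolding cub_part_def by (intro sum.cong) (auto simp: w_def)
    thus ?thesis using k_ge_4 by simp
  qed
  have "eigval w = Re (C 0 0) + (\<Sum>y\<in>UNIV - {0}. Re (C (a * y ^ 3) (b * y))) - real CARD('a)"
    unfolding eigval_def L F by (subst sum.remove[of _ 0]) auto
  also have "(\<Sum>y\<in>UNIV - {0}. Re (C (a * y ^ 3) (b * y))) = (\<Sum>y\<in>UNIV - {0::'a}. max_sum)"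
    by (intro sum.cong) (auto simp: C_scale ab(3))
  also have "\<dots> = (real CARD('a) - 1) * max_sum"
    using q_ge_5 by (simp add: card_Diff_singleton of_nat_diff)
  finally show ?thesis using that[OF wV w0] by (simp add: C_0_0)
qed

section \<open>The second largest eigenvalue and connectedness\<close>

lemma lambda2_eq:
  "lambda2 V (cubic_adj k) = max (real CARD('a) * (real k - 3)) ((real CARD('a) - 1) * max_sum)"
proof -
  obtain w0 where w0: "w0 \<in> V" "w0 \<noteq> (\<lambda>_. 0)"
    "eigval w0 = max (real CARD('a) * (real k - 3)) ((real CARD('a) - 1) * max_sum)"
    using eigval_attains_linear eigval_attains_max_sum unfolding max_def by metis
  show ?thesis
    by (rule lambda2_eqI[where ev = eigval and z = "\<lambda>_. 0", OF finite_V spectrum V_zero _ _ w0])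
      (simp_all add: eigval_zero eigval_le eigval_nonzero_le)
qed

text \<open>Both candidates stay below the valency \<open>q * (q - 1)\<close>, as
  \<open>k - 3 \<le> q - 2\<close> and \<open>max_sum < q\<close>.\<close>

lemma eigval_nonzero_less:
  assumes "w \<in> V" "w \<noteq> (\<lambda>_. 0)"
  shows "eigval w < real CARD('a) * real CARD('a) - real CARD('a)"
proof -
  have "real CARD('a) * (real k - 3) < real CARD('a) * (real CARD('a) - 1)"
    using k_le q_ge_5 by (intro mult_strict_left_mono) auto
  moreover have "(real CARD('a) - 1) * max_sum < (real CARD('a) - 1) * real CARD('a)"
    using max_sum_less q_ge_5 by (intro mult_strict_left_mono) auto
  ultimately show ?thesis using eigval_nonzero_le[OF assms] by (simp add: algebra_simps max_def split: if_splits)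
qed

text \<open>Let \<open>R\<close> be the set reached from \<open>u\<close>. Translation by a step
  permutes \<open>R\<close>, so a character that is not 1 on some step sums to 0 over
  \<open>R\<close>. Only the trivial character then contributes to the Fourier expansion of the
  indicator of \<open>R\<close>, which is therefore constant.\<close>

lemma connected: "graph_connected V (cubic_adj k)"
  unfolding graph_connected_def
proof (intro ballI)
  fix u t assume u: "u \<in> V" and t: "t \<in> V"
  let ?E = "\<lambda>x y. x \<in> V \<and> y \<in> V \<and> cubic_adj k x y"
  define R where "R = {v \<in> V. ?E\<^sup>*\<^sup>* u v}"
  have finR: "finite R" and RV: "R \<subseteq> V" and uR: "u \<in> R" using finite_V u by (auto simp: R_def)
  have R_step: "(\<lambda>i. v i + graph_step k x y i) \<in> R" if "v \<in> R" "x \<noteq> 0" for v x y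
  proof -
    have v: "v \<in> V" using that RV by auto
    have "?E v (\<lambda>i. v i + graph_step k x y i)"
      unfolding adj_iff using v that(2) V_add[OF v step_in_V[of x y]] by auto
    moreover have "?E\<^sup>*\<^sup>* u v" using that by (simp add: R_def)
    ultimately show ?thesis unfolding R_def by (auto intro: rtranclp.rtrancl_into_rtrancl)
  qed
  have zero: "(\<Sum>v\<in>R. chi w v) = 0" if w: "w \<in> V" "w \<noteq> (\<lambda>_. 0)" for w
  proof -
    \<comment> \<open>If \<open>chi w\<close> were 1 on all steps, its eigenvalue would be the
      valency.\<close>
    have "\<exists>x y. x \<noteq> 0 \<and> chi w (graph_step k x y) \<noteq> 1"
    proof (rule ccontr)
      assume "\<not> ?thesis"
      hence "complex_of_real (eigval w) = (\<Sum>x\<in>UNIV - {0::'a}. \<Sum>y\<in>(UNIV::'a set). 1)"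
        unfolding sum_chi_steps[symmetric] by (intro sum.cong refl) auto
      also have "\<dots> = of_real (real CARD('a) * real CARD('a) - real CARD('a))"
        using q_ge_5 by (simp add: card_Diff_singleton of_nat_diff algebra_simps)
      finally show False using eigval_nonzero_less[OF w] by (simp only: of_real_eq_iff)
    qed
    then obtain x y where xy: "x \<noteq> 0" "chi w (graph_step k x y) \<noteq> 1" by blast
    define h where "h v i = v i + graph_step k x y i" for v i
    have inj: "inj_on h R" by (rule inj_onI) (auto simp: h_def fun_eq_iff)
    have "h ` R \<subseteq> R" using R_step[OF _ xy(1)] by (auto simp: h_def[abs_def])
    hence "h ` R = R" by (rule endo_inj_surj[OF finR _ inj])
    hence "(\<Sum>v\<in>R. chi w v) = (\<Sum>v\<in>R. chi w (h v))"
      using sum.reindex[OF inj, of "chi w"] by simp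
    also have "\<dots> = chi w (graph_step k x y) * (\<Sum>v\<in>R. chi w v)"
      by (simp only: h_def[abs_def] chi_add sum_distrib_left
          mult.commute[of "chi w (graph_step k x y)"])
    finally show ?thesis using xy(2) by simp
  qed
  \<comment> \<open>Fourier inversion at \<open>t\<close>: by orthogonality the double sum detects
    whether \<open>t\<close> lies in \<open>R\<close>, while by \<open>zero\<close> it equals
    \<open>card R\<close>, which is positive.\<close>
  have "(\<Sum>w\<in>V. cnj (chi w t) * (\<Sum>v\<in>R. chi w v)) = (\<Sum>v\<in>R. \<Sum>w\<in>V. cnj (chi t w) * chi v w)"
    by (simp add: sum_distrib_left chi_commute[of _ t]) (subst sum.swap, simp add: chi_commute)
  also have "\<dots> = (\<Sum>v\<in>R. if t = v then of_nat (card V) else 0)"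
    by (intro sum.cong refl chi_orthogonal) (use t RV in auto)
  also have "\<dots> = (if t \<in> R then of_nat (card V) else 0)" using finR by simp
  finally have 1: "(\<Sum>w\<in>V. cnj (chi w t) * (\<Sum>v\<in>R. chi w v)) = (if t \<in> R then of_nat (card V) else 0)" .
  have "(\<Sum>w\<in>V. cnj (chi w t) * (\<Sum>v\<in>R. chi w v))
      = (\<Sum>w\<in>V. if w = (\<lambda>_. 0) then of_nat (card R) else 0)"
    by (intro sum.cong refl) (auto simp: zero, simp add: graph_char_def)
  also have "\<dots> = of_nat (card R)" using finite_V V_zero by simp
  finally have "of_nat (card R) = (if t \<in> R then of_nat (card V) else 0 :: complex)" using 1 by simp
  moreover have "card R > 0" using finR uR by (auto simp: card_gt_0_iff)
  ultimately have "t \<in> R" by (auto split: if_splits)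
  thus "?E\<^sup>*\<^sup>* u t" by (simp add: R_def)
qed

end

theorem theorem3:
  fixes e k :: nat
  assumes "CARD('a::{field,finite}) = CHAR('a) ^ e"
    and "odd CARD('a)"
    and "CARD('a) mod 3 = 2"
    and "4 \<le> k" and "k \<le> CARD('a) + 1"
  defines "Mq \<equiv> Max {Re (expsum e (\<lambda>x::'a. a * x ^ 3 + b * x)) | a b. a \<noteq> 0 \<and> b \<noteq> 0}"
  shows "graph_connected (S_verts k :: (nat \<Rightarrow> 'a) set)
           (S_adj k (\<lambda>i x. x ^ (i - 1)) (\<lambda>i x. x ^ 3))
       \<and> lambda2 (S_verts k :: (nat \<Rightarrow> 'a) set) (S_adj k (\<lambda>i x. x ^ (i - 1)) (\<lambda>i x. x ^ 3))
           = max (real CARD('a) * (real k - 3)) ((real CARD('a) - 1) * Mq)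
       \<and> Mq \<le> 2 * sqrt (real CARD('a))"
  using connected[OF assms(1-5) Mq_def[THEN meta_eq_to_obj_eq]]
    lambda2_eq[OF assms(1-5) Mq_def[THEN meta_eq_to_obj_eq]]
    max_sum_le[OF assms(1-5) Mq_def[THEN meta_eq_to_obj_eq]] by blast

end
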